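(* Let $K\ge1$, $s\ge0$, $1\le R_1,R_2\le K$, and let $\Delta=(\mathbf w,\mathcal R_1,\phi)$ be an irreducible substructure with $w_j>0$ for all $1\le j\le K$. Then the number of arrowed arrays in $\mathrm{AR}(K,R_1,R_2,s)$ belonging to $\Delta$ is \[ T(\Delta)=s!\sum_{A=0}^{s-1}\frac{r}{s-A}\binom{M}{M-A}\binom{K-M-1}{R_2-M+A-1}, \] where $r=\sum_{j\in\mathcal R_1}w_j$ and $M$ is the number of columns containing a critical vertex in row 1.
   Context: Two-row vertical arrays: for $K\ge1$, $s\ge0$, $1\le R_1,R_2\le K$, such an array is a $2\times K$ grid of cells, each cell containing a possibly empty left-to-right ordered list of unlabelled vertices, each row containing $s$ vertices, the vertices partitioned into $s$ pairs each consisting of one vertex of row 1 and one of row 2 (partners), with exactly $R_1$ marked cells in row 1 and $R_2$ in row 2. Arrays are equal if they have the same vertex counts per cell, marked cells and pairing of vertex positions. Arrowed array: a pair $(\alpha,\phi)$ where $\alpha$ is such an array and $\phi$ is a function from a subset $\mathcal H\subseteq\{1,\dots,K\}\setminus\mathcal R_1$ to $\{1,\dots,K\}$, $\mathcal R_1$ being the set of marked columns of row 1 (one says column $j\in\mathcal H$ has an arrow-tail and points to $\phi(j)$, which holds an arrow-head). A vertex is critical if it is the rightmost vertex of its cell and that cell is neither marked nor a row-1 cell $(1,j)$ with $j\in\mathcal H$. Forest condition: let $\mathcal F_i$ be the set of columns whose row-$i$ cell is nonempty and $\mathcal R_2$ the marked columns of row 2; define $\psi_1$ on $(\mathcal H\cup\mathcal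 F_1)\setminus\mathcal R_1$ by $\psi_1(j)=\phi(j)$ for $j\in\mathcal H$ and, for $j\in\mathcal F_1\setminus(\mathcal H\cup\mathcal R_1)$, $\psi_1(j)=$ the column of the partner of the rightmost vertex of cell $(1,j)$; define $\psi_2$ on $\mathcal F_2\setminus\mathcal R_2$ by $\psi_2(j)=$ the column of the partner of the rightmost vertex of cell $(2,j)$. The forest condition holds if for $i=1,2$ every $j$ in the domain of $\psi_i$ has some $t\ge1$ with $\psi_i^t(j)$ defined and in $\mathcal R_i$. $\mathrm{AR}(K,R_1,R_2,s)$ is the set of arrowed arrays satisfying the forest condition. Substructure $\Delta$: given $\mathbf w=(w_1,\dots,w_K)$ non-negative integers with $\sum_jw_j=s$, an $R_1$-subset $\mathcal R_1$ of columns, and $\phi$ a function from $\mathcal H\subseteq\{1,\dots,K\}\setminus\mathcal R_1$ to $\{1,\dots,K\}$, $\Delta=(\mathbf w,\mathcal R_1,\phi)$ is the set of $(\alpha,\phi')\in\mathrm{AR}(K,R_1,R_2,s)$ with $\phi'=\phi$, row-1 marked set equal to $\mathcal R_1$, and both cells $(1,j)$ and $(2,j)$ containing exactly $w_j$ vertices for every $j$; $T(\Delta)$ is its cardinality. $\Delta$ is irreducible if the functional digraph of $\phi$ is acyclic and for every $j\in\mathcal H$, $\phi(j)\notin\mathcal R_1\cup\mathcal H$. (Thus the columns containing a critical vertex in row 1 are those $j\notin\mathcal R_1\cup\mathcal H$ with $w_j\ge1$.) Binomial coefficients $\binom{a}{b}$ with $b<0$ or $b>a$ are $0$. *)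

theory Defs
  imports Complex_Main "HOL-Library.FuncSet"
begin

datatype row = Row1 | Row2

text \<open>
  Columns are the numbers \<open>1, \<dots>, K\<close>.  A vertex of a given row is encoded as
  \<open>(j, p)\<close>: the \<open>p\<close>-th vertex from the left (counting from 1) in the cell of column \<open>j\<close>.
\<close>

type_synonym vertex = "nat \<times> nat"

text \<open>The pairing sends each vertex of row 1 to its partner in row 2.\<close>

record vertical_array =
  size_of :: "row \<Rightarrow> nat \<Rightarrow> nat"
  marked :: "row \<Rightarrow> nat set"
  pairing :: "vertex \<Rightarrow> vertex"

definition vertices :: "nat \<Rightarrow> (nat \<Rightarrow> nat) \<Rightarrow> vertex set" where
  "vertices K n = (SIGMA j:{1..K}. {1..n j})"

definition rightmost :: "(nat \<Rightarrow> nat) \<Rightarrow> nat \<Rightarrow> vertex" where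
  "rightmost n j = (j, n j)"

text \<open>
  The cell sizes vanish outside the grid and the pairing is extensional, so that equality of
  the HOL records is equality of arrays (in particular, cardinalities count arrays correctly).
\<close>

definition is_vertical_array ::
    "nat \<Rightarrow> nat \<Rightarrow> nat \<Rightarrow> nat \<Rightarrow> vertical_array \<Rightarrow> bool" where
  "is_vertical_array K R1 R2 s \<alpha> \<longleftrightarrow>
     (\<forall>i. \<forall>j. j \<notin> {1..K} \<longrightarrow> size_of \<alpha> i j = 0) \<and>
     (\<forall>i. (\<Sum>j\<in>{1..K}. size_of \<alpha> i j) = s) \<and>
     (\<forall>i. marked \<alpha> i \<subseteq> {1..K}) \<and>
     card (marked \<alpha> Row1) = R1 \<and>
     card (marked \<alpha> Row2) = R2 \<and>
     pairing \<alpha> \<in> extensional (vertices K (size_of \<alpha> Row1)) \<and>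
     bij_betw (pairing \<alpha>) (vertices K (size_of \<alpha> Row1)) (vertices K (size_of \<alpha> Row2))"

definition partner :: "nat \<Rightarrow> vertical_array \<Rightarrow> row \<Rightarrow> vertex \<Rightarrow> vertex" where
  "partner K \<alpha> i =
     (case i of Row1 \<Rightarrow> pairing \<alpha>
              | Row2 \<Rightarrow> inv_into (vertices K (size_of \<alpha> Row1)) (pairing \<alpha>))"

text \<open>
  The arrows are a partial map \<open>\<phi>\<close> on columns; the set of columns with an arrow-tail is
  \<open>dom \<phi>\<close>.
\<close>

definition is_arrow_map :: "nat \<Rightarrow> nat set \<Rightarrow> (nat \<rightharpoonup> nat) \<Rightarrow> bool" where
  "is_arrow_map K \<R>1 \<phi> \<longleftrightarrow> dom \<phi> \<subseteq> {1..K} - \<R>1 \<and> ran \<phi> \<subseteq> {1..K}"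

definition psi1 :: "nat \<Rightarrow> vertical_array \<Rightarrow> (nat \<rightharpoonup> nat) \<Rightarrow> (nat \<rightharpoonup> nat)" where
  "psi1 K \<alpha> \<phi> j =
     (if j \<in> marked \<alpha> Row1 then None
      else if j \<in> dom \<phi> then \<phi> j
      else if j \<in> {1..K} \<and> size_of \<alpha> Row1 j > 0
        then Some (fst (partner K \<alpha> Row1 (rightmost (size_of \<alpha> Row1) j)))
      else None)"

definition psi2 :: "nat \<Rightarrow> vertical_array \<Rightarrow> (nat \<rightharpoonup> nat)" where
  "psi2 K \<alpha> j =
     (if j \<in> marked \<alpha> Row2 then None
      else if j \<in> {1..K} \<and> size_of \<alpha> Row2 j > 0
        then Some (fst (partner K \<alpha> Row2 (rightmost (size_of \<alpha> Row2) j)))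
      else None)"

text \<open>
  \<open>(j, k) \<in> Map.graph \<psi> ^^ t\<close> says that the iterate \<open>\<psi>\<^sup>t(j)\<close> is defined and equal to \<open>k\<close>.
\<close>

definition leads_to :: "(nat \<rightharpoonup> nat) \<Rightarrow> nat set \<Rightarrow> bool" where
  "leads_to \<psi> \<R> \<longleftrightarrow> (\<forall>j\<in>dom \<psi>. \<exists>t\<ge>1. \<exists>k\<in>\<R>. (j, k) \<in> Map.graph \<psi> ^^ t)"

definition forest_condition :: "nat \<Rightarrow> vertical_array \<Rightarrow> (nat \<rightharpoonup> nat) \<Rightarrow> bool" where
  "forest_condition K \<alpha> \<phi> \<longleftrightarrow>
     leads_to (psi1 K \<alpha> \<phi>) (marked \<alpha> Row1) \<and> leads_to (psi2 K \<alpha>) (marked \<alpha> Row2)"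

definition AR ::
    "nat \<Rightarrow> nat \<Rightarrow> nat \<Rightarrow> nat \<Rightarrow> (vertical_array \<times> (nat \<rightharpoonup> nat)) set" where
  "AR K R1 R2 s =
     {(\<alpha>, \<phi>). is_vertical_array K R1 R2 s \<alpha> \<and> is_arrow_map K (marked \<alpha> Row1) \<phi> \<and>
              forest_condition K \<alpha> \<phi>}"

definition substructure_data ::
    "nat \<Rightarrow> nat \<Rightarrow> nat \<Rightarrow> (nat \<Rightarrow> nat) \<Rightarrow> nat set \<Rightarrow> (nat \<rightharpoonup> nat) \<Rightarrow> bool" where
  "substructure_data K R1 s w \<R>1 \<phi> \<longleftrightarrow>
     (\<Sum>j\<in>{1..K}. w j) = s \<and> \<R>1 \<subseteq> {1..K} \<and> card \<R>1 = R1 \<and> is_arrow_map K \<R>1 \<phi>"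

definition substructure ::
    "nat \<Rightarrow> nat \<Rightarrow> nat \<Rightarrow> nat \<Rightarrow> (nat \<Rightarrow> nat) \<Rightarrow> nat set \<Rightarrow> (nat \<rightharpoonup> nat) \<Rightarrow>
      (vertical_array \<times> (nat \<rightharpoonup> nat)) set" where
  "substructure K R1 R2 s w \<R>1 \<phi> =
     {(\<alpha>, \<phi>') \<in> AR K R1 R2 s. \<phi>' = \<phi> \<and> marked \<alpha> Row1 = \<R>1 \<and>
        (\<forall>i. \<forall>j\<in>{1..K}. size_of \<alpha> i j = w j)}"

definition irreducible_substructure :: "nat set \<Rightarrow> (nat \<rightharpoonup> nat) \<Rightarrow> bool" where
  "irreducible_substructure \<R>1 \<phi> \<longleftrightarrow>
     acyclic (Map.graph \<phi>) \<and> (\<forall>j\<in>dom \<phi>. the (\<phi> j) \<notin> \<R>1 \<union> dom \<phi>)"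

text \<open>
  Critical vertices of a row with cell sizes \<open>n\<close>, marked columns \<open>\<R>\<close> and arrow-tail columns
  \<open>H\<close>.  Only row 1 carries arrow-tails; for row 2 one takes \<open>H = {}\<close>.  For row 1
  these data are determined by a substructure, hence so are the critical columns of row 1.
\<close>

definition critical :: "nat \<Rightarrow> (nat \<Rightarrow> nat) \<Rightarrow> nat set \<Rightarrow> nat set \<Rightarrow> vertex \<Rightarrow> bool" where
  "critical K n \<R> H v \<longleftrightarrow>
     v \<in> vertices K n \<and> v = rightmost n (fst v) \<and> fst v \<notin> \<R> \<union> H"

definition critical_columns :: "nat \<Rightarrow> (nat \<Rightarrow> nat) \<Rightarrow> nat set \<Rightarrow> nat set \<Rightarrow> nat set" where
  "critical_columns K n \<R> H = {j. \<exists>v. critical K n \<R> H v \<and> fst v = j}"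

text \<open>Binomial coefficients with integer arguments, zero when \<open>b < 0\<close> or \<open>b > a\<close>.\<close>

definition ibinom :: "int \<Rightarrow> int \<Rightarrow> nat" where
  "ibinom a b = (if b < 0 \<or> b > a then 0 else nat a choose nat b)"

end

(*
  Fix the set U of unmarked columns of row 2 and regard the pairing as a permutation of the
  vertices.  If part of a random permutation is prescribed without creating a cycle, then the
  probability that the functional graph on the critical columns is a forest is the proportion of
  the still available vertices whose column is already connected to a root.

  Reveal first the partners of the critical vertices of row 1.  The arrows of the second row that
  become known are reversed arrows of the first row, so they contain no cycle once the first row
  is a forest, and they form disjoint paths.  Hence the number of good pairings is governed by the
  number of noncritical vertices of row 1 whose path leaves U.  Decomposing according to the
  columns of this path and summing over U and over the starting vertex, the dependence on the path
  cancels except for its length p, and with u = K - R2 this gives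
    T = r * (sum over p of M! / (M - p)! * (s - p - 1)! * binom (K - 1 - p) (u - p)).
  Vandermonde's identity turns this into the stated form.
*)

theory Submission
  imports Defs "HOL-Combinatorics.Permutations"
begin

section \<open>Sums and finite sets\<close>

text \<open>The two forest conditions constrain one and the same permutation, the first through
  \<sigma> and the second through its inverse, so they are not independent. The partners of the
  critical vertices uncouple them: they decide the first condition completely, yet disclose too
  little of row 2 to close a cycle there. The denominator of the resulting proportion is the number
  s - M of noncritical vertices, whatever the pairing; the same factor comes out of the sum over
  starting vertices and cancels. In the sum over p, M! / (M - p)! counts the lists of p distinct
  critical columns along a path, (s - p - 1)! comes from the row-1 forests with p prescribed
  partners, and the binomial counts the sets U that contain every column of the path except its last
  one. After Vandermonde's identity the inner sum over p equals s! / (s - A), which is the origin of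
  the denominators s - A.\<close>

lemma card_subsets_between:
  assumes "finite A" "B \<subseteq> A" "z \<in> A - B"
  shows "card {U. U \<subseteq> A \<and> card U = u \<and> B \<subseteq> U \<and> z \<notin> U} =
    (if card B \<le> u then (card A - 1 - card B) choose (u - card B) else 0)"
proof (cases "card B \<le> u")
  case True
  have finB: "finite B" using assms finite_subset by auto
  let ?A' = "A - {z} - B"
  have cardA': "card ?A' = card A - 1 - card B"
    using assms finB by (subst card_Diff_subset) auto
  have "bij_betw (\<lambda>W. W \<union> B) {W. W \<subseteq> ?A' \<and> card W = u - card B}
      {U. U \<subseteq> A \<and> card U = u \<and> B \<subseteq> U \<and> z \<notin> U}"
  proof (rule bij_betw_byWitness[where f' = "\<lambda>U. U - B"])
    show "(\<lambda>W. W \<union> B) ` {W. W \<subseteq> ?A' \<and> card W = u - card B} \<subseteq>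
      {U. U \<subseteq> A \<and> card U = u \<and> B \<subseteq> U \<and> z \<notin> U}"
    proof clarify
      fix W assume W: "W \<subseteq> ?A'" "card W = u - card B"
      then have "finite W" using assms finite_subset by blast
      with W finB have "card (W \<union> B) = card W + card B"
        by (intro card_Un_disjoint) auto
      with W True assms show "W \<union> B \<subseteq> A \<and> card (W \<union> B) = u \<and> B \<subseteq> W \<union> B \<and> z \<notin> W \<union> B" by auto
    qed
    show "(\<lambda>U. U - B) ` {U. U \<subseteq> A \<and> card U = u \<and> B \<subseteq> U \<and> z \<notin> U} \<subseteq>
      {W. W \<subseteq> ?A' \<and> card W = u - card B}"
      using finB by (auto simp: card_Diff_subset)
  qed auto
  then show ?thesis
    using True n_subsets[of ?A' "u - card B"] assms(1) cardA' by (simp add: bij_betw_same_card[symmetric])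
next
  \<comment> \<open>Here the truncated \<open>u - card B\<close> is 0, so an unguarded binomial
    would yield 1 instead of 0.\<close>
  case False
  have "card B \<le> card U" if "U \<subseteq> A" "B \<subseteq> U" for U
    using that assms by (meson card_mono finite_subset)
  then have "{U. U \<subseteq> A \<and> card U = u \<and> B \<subseteq> U \<and> z \<notin> U} = {}" using False by auto
  with False show ?thesis by (simp only: card.empty if_False)
qed

text \<open>Write f A s for the sum. With s = t + 1, splitting off p = 0 and taking the factor A + 1
  out of the rest gives f (A + 1) s = t! + (A + 1) * f A t, and t! + (A + 1) * t! / (t - A) = s! /
  (t - A).\<close>

lemma sum_falling_fact:
  assumes "A < s"
  shows "(\<Sum>p\<le>A. fact A / fact (A - p) * fact (s - p - 1)) = fact s / (real s - real A)"
  using assms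
proof (induction A arbitrary: s)
  case 0
  then show ?case by (simp add: fact_reduce)
next
  case (Suc A)
  then obtain t where t: "s = Suc t" "A < t" by (cases s) auto
  have "(\<Sum>p\<le>Suc A. fact (Suc A) / fact (Suc A - p) * fact (s - p - 1)) =
    fact t + real (Suc A) * (\<Sum>p\<le>A. fact A / fact (A - p) * fact (t - p - 1))"
    by (subst sum.atMost_Suc_shift) (simp add: t sum_distrib_left mult.assoc)
  also have "\<dots> = fact t + real (Suc A) * (fact t / (real t - real A))"
    using Suc.IH[OF t(2)] by simp
  also have "\<dots> = fact s / (real s - real (Suc A))"
    using t by (simp add: field_simps)
  finally show ?case .
qed

lemma real_prod_interval: "p \<le> M \<Longrightarrow> real (\<Prod>{M - p + 1..M}) = fact M / fact (M - p)"
  using arg_cong[OF fact_eq_fact_times[of "M - p" M], of real]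
  by (simp add: field_simps del: of_nat_prod)

text \<open>Vandermonde's identity splits K - 1 - p into M - p and K - M - 1, with u - A elements
  taken from the second group. Because M! / (M - p)! * binom (M - p) (A - p) = binom M A * A! / (A -
  p)!, the sum over p becomes that of \<open>sum_falling_fact\<close>.\<close>

lemma sum_falling_binomial:
  fixes K M s u :: nat
  assumes "M < s" "M < K"
  shows "(\<Sum>p\<le>M. fact M / fact (M - p) * fact (s - p - 1) *
        real (if p \<le> u then (K - 1 - p) choose (u - p) else 0)) =
    fact s * (\<Sum>A\<le>M. 1 / (real s - real A) * real (M choose A) *
        real (if A \<le> u then (K - M - 1) choose (u - A) else 0))"
proof -
  define c where "c A = (if A \<le> u then (K - M - 1) choose (u - A) else 0)" for A
  have vand: "(if p \<le> u then (K - 1 - p) choose (u - p) else 0) =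
    (\<Sum>A\<le>M. if p \<le> A then ((M - p) choose (A - p)) * c A else 0)" if p: "p \<le> M" for p
  proof (cases "p \<le> u")
    case True
    \<comment> \<open>Either of M and u may be the larger one. Terms beyond M vanish through the
      first binomial and terms beyond u through \<open>c\<close>, so the range passes through the
      maximum.\<close>
    have "(\<Sum>A\<le>M. if p \<le> A then ((M - p) choose (A - p)) * c A else 0) =
      (\<Sum>A\<in>{p..max M u}. ((M - p) choose (A - p)) * c A)"
      using p by (intro sum.mono_neutral_cong) (auto simp: binomial_eq_0)
    also have "\<dots> = (\<Sum>A\<in>{p..u}. ((M - p) choose (A - p)) * c A)"
      by (rule sum.mono_neutral_right) (auto simp: c_def)
    also have "\<dots> = (\<Sum>i\<le>u - p. ((M - p) choose i) * ((K - M - 1) choose (u - p - i)))"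
      using True
      by (intro sum.reindex_bij_witness[of _ "\<lambda>i. i + p" "\<lambda>A. A - p"]) (auto simp: c_def)
    also have "\<dots> = (M - p + (K - M - 1)) choose (u - p)" by (rule vandermonde)
    also have "M - p + (K - M - 1) = K - 1 - p" using assms p by simp
    finally show ?thesis using True by simp
  next
    case False
    then have "(\<Sum>A\<le>M. if p \<le> A then ((M - p) choose (A - p)) * c A else 0) = 0"
      by (intro sum.neutral) (auto simp: c_def)
    with False show ?thesis by simp
  qed
  have "(\<Sum>p\<le>M. fact M / fact (M - p) * fact (s - p - 1) *
        real (if p \<le> u then (K - 1 - p) choose (u - p) else 0)) =
    (\<Sum>p\<le>M. \<Sum>A\<le>M. if p \<le> A then fact M / fact (M - p) * fact (s - p - 1) *
        (real ((M - p) choose (A - p)) * real (c A)) else 0)"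
  proof (intro sum.cong refl)
    fix p assume "p \<in> {..M}"
    then have "p \<le> M" by simp
    show "fact M / fact (M - p) * fact (s - p - 1) *
        real (if p \<le> u then (K - 1 - p) choose (u - p) else 0) =
      (\<Sum>A\<le>M. if p \<le> A then fact M / fact (M - p) * fact (s - p - 1) *
        (real ((M - p) choose (A - p)) * real (c A)) else 0)"
      unfolding vand[OF \<open>p \<le> M\<close>] of_nat_sum sum_distrib_left
      by (intro sum.cong refl) simp
  qed
  also have "\<dots> = (\<Sum>A\<le>M. \<Sum>p\<le>M. if p \<le> A then fact M / fact (M - p) * fact (s - p - 1) *
        (real ((M - p) choose (A - p)) * real (c A)) else 0)"
    by (rule sum.swap)
  also have "\<dots> = (\<Sum>A\<le>M. real (M choose A) * real (c A) *
        (\<Sum>p\<le>A. fact A / fact (A - p) * fact (s - p - 1)))"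
  proof (intro sum.cong refl)
    fix A assume "A \<in> {..M}"
    then have A: "A \<le> M" by simp
    have "(\<Sum>p\<le>M. if p \<le> A then fact M / fact (M - p) * fact (s - p - 1) *
        (real ((M - p) choose (A - p)) * real (c A)) else 0) =
      (\<Sum>p\<le>A. fact M / fact (M - p) * fact (s - p - 1) * (real ((M - p) choose (A - p)) * real (c A)))"
      using A by (intro sum.mono_neutral_cong_right) auto
    also have "\<dots> = (\<Sum>p\<le>A. real (M choose A) * real (c A) * (fact A / fact (A - p) * fact (s - p - 1)))"
    proof (intro sum.cong refl)
      fix p assume "p \<in> {..A}"
      then have "real ((M - p) choose (A - p)) = fact (M - p) / (fact (A - p) * fact (M - A))"
        "real (M choose A) = fact M / (fact A * fact (M - A))"
        using A binomial_fact[of "A - p" "M - p", where 'a = real] binomial_fact[OF A, where 'a = real] by auto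
      then show "fact M / fact (M - p) * fact (s - p - 1) * (real ((M - p) choose (A - p)) * real (c A)) =
        real (M choose A) * real (c A) * (fact A / fact (A - p) * fact (s - p - 1))"
        by (simp add: mult_ac)
    qed
    finally show "(\<Sum>p\<le>M. if p \<le> A then fact M / fact (M - p) * fact (s - p - 1) *
        (real ((M - p) choose (A - p)) * real (c A)) else 0) =
      real (M choose A) * real (c A) * (\<Sum>p\<le>A. fact A / fact (A - p) * fact (s - p - 1))"
      by (simp add: sum_distrib_left)
  qed
  also have "\<dots> = (\<Sum>A\<le>M. fact s * (1 / (real s - real A) * real (M choose A) * real (c A)))"
    using assms by (intro sum.cong refl) (subst sum_falling_fact; simp)
  finally show ?thesis by (simp add: c_def sum_distrib_left)
qed

section \<open>Functional forests in permutations\<close>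

lemma acyclic_reaches_sink:
  assumes "finite r" "acyclic r"
  obtains z where "(x, z) \<in> r\<^sup>*" "z \<notin> Domain r"
proof -
  have "wf (r\<inverse>)"
    using assms by (rule finite_acyclic_wf_converse)
  then have "\<exists>z. (x, z) \<in> r\<^sup>* \<and> z \<notin> Domain r"
  proof (induction x rule: wf_induct_rule)
    case (less x)
    show ?case
    proof (cases "x \<in> Domain r")
      case True
      then obtain y where "(x, y) \<in> r" by auto
      with less[of y] show ?thesis
        by (auto intro: converse_rtrancl_into_rtrancl)
    qed auto
  qed
  with that show thesis by auto
qed

lemma Not_Range_rtrancl: "y \<notin> Range r \<Longrightarrow> (x, y) \<in> r\<^sup>* \<longleftrightarrow> x = y"
  by (metis Range.RangeI rtranclE rtrancl.rtrancl_refl)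

lemma sink_unique:
  assumes "single_valued r" "(x, y) \<in> r\<^sup>*" "(x, z) \<in> r\<^sup>*" "y \<notin> Domain r" "z \<notin> Domain r"
  shows "y = z"
  using single_valued_confluent[OF assms(1-3)] assms(4,5)
  by (metis Domain.DomainI converse_rtranclE)

text \<open>Without cycles an orbit must stop outside the domain, and the range condition forces it
  to stop in \<R>. Conversely, since \<psi> is single-valued, an orbit on a cycle can always return
  to its start; it therefore never meets a point of \<R>, where \<psi> is undefined.\<close>

lemma leads_to_iff_acyclic:
  assumes fin: "finite (dom \<psi>)" and disj: "dom \<psi> \<inter> \<R> = {}" and ran: "ran \<psi> \<subseteq> dom \<psi> \<union> \<R>"
  shows "leads_to \<psi> \<R> \<longleftrightarrow> acyclic (Map.graph \<psi>)"
proof -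
  let ?r = "Map.graph \<psi>"
  have D: "Domain ?r = dom \<psi>" and sv: "single_valued ?r"
    by (auto simp: Map.graph_def single_valued_def)
  have finr: "finite ?r"
    using fin by (simp add: finite_graph_iff_finite_dom)
  have *: "(\<exists>t\<ge>1. \<exists>k\<in>\<R>. (j, k) \<in> ?r ^^ t) \<longleftrightarrow> (\<exists>k\<in>\<R>. (j, k) \<in> ?r\<^sup>+)" for j
    by (auto simp: trancl_power Suc_le_eq)
  show ?thesis
  proof
    assume L: "leads_to \<psi> \<R>"
    show "acyclic ?r"
    proof (rule acyclicI, rule allI, rule notI)
      fix j assume jj: "(j, j) \<in> ?r\<^sup>+"
      then have "j \<in> dom \<psi>" using D tranclD by fastforce
      with L obtain k where k: "k \<in> \<R>" "(j, k) \<in> ?r\<^sup>+"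
        unfolding leads_to_def * by auto
      have "(k, j) \<in> ?r\<^sup>*" if "(j, k) \<in> ?r\<^sup>+" for k
        using that
      proof (induction rule: trancl_induct)
        case (base y)
        from jj obtain z where "(j, z) \<in> ?r" "(z, j) \<in> ?r\<^sup>*"
          by (meson tranclD)
        with base sv show ?case by (auto dest: single_valuedD)
      next
        case (step y z)
        have "(y, j) \<in> ?r\<^sup>+"
        proof (cases "y = j")
          case False
          with step.IH show ?thesis by (simp add: rtrancl_eq_or_trancl)
        qed (simp add: jj)
        then obtain z' where "(y, z') \<in> ?r" "(z', j) \<in> ?r\<^sup>*"
          by (meson tranclD)
        with step sv show ?case by (auto dest: single_valuedD)
      qed
      with k have "(k, j) \<in> ?r\<^sup>*" by blast
      moreover have "k \<noteq> j" using k \<open>j \<in> dom \<psi>\<close> disj by auto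
      ultimately have "k \<in> Domain ?r" by (metis Domain.DomainI converse_rtranclE)
      with k disj D show False by auto
    qed
  next
    assume A: "acyclic ?r"
    show "leads_to \<psi> \<R>"
      unfolding leads_to_def *
    proof
      fix j assume "j \<in> dom \<psi>"
      obtain z where z: "(j, z) \<in> ?r\<^sup>*" "z \<notin> Domain ?r"
        using acyclic_reaches_sink[OF finr A] .
      with \<open>j \<in> dom \<psi>\<close> D have t: "(j, z) \<in> ?r\<^sup>+" by (metis rtranclD)
      then have "z \<in> Range ?r" by (metis Range_iff tranclD2)
      then have "z \<in> ran \<psi>" by (auto simp: Map.graph_def ran_def)
      with ran z D have "z \<in> \<R>" by auto
      with t show "\<exists>k\<in>\<R>. (j, k) \<in> ?r\<^sup>+" by auto
    qed
  qed
qed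

text \<open>One extension \<tau> of \<open>g\<close> to a permutation is fixed; composing it with
  the permutations of \<open>V - P\<close> produces all the others.\<close>

lemma card_permutations_extending:
  assumes "finite V" "P \<subseteq> V" "inj_on g P" "g ` P \<subseteq> V"
  shows "card {\<sigma>. \<sigma> permutes V \<and> (\<forall>a\<in>P. \<sigma> a = g a)} = fact (card V - card P)"
proof -
  have "card (V - P) = card (V - g ` P)"
    using assms by (simp add: card_Diff_subset finite_subset card_image)
  then obtain h where h: "bij_betw h (V - P) (V - g ` P)"
    using assms by (metis finite_Diff finite_same_card_bij)
  define \<tau> where "\<tau> x = (if x \<in> P then g x else if x \<in> V then h x else x)" for x
  have "bij_betw \<tau> P (g ` P)"
    using assms by (auto simp: \<tau>_def bij_betw_def inj_on_def)
  moreover have "bij_betw \<tau> (V - P) (V - g ` P)"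
    using h by (rule bij_betw_cong[THEN iffD1, rotated]) (auto simp: \<tau>_def)
  ultimately have "bij_betw \<tau> (P \<union> (V - P)) (g ` P \<union> (V - g ` P))"
    by (rule bij_betw_combine) auto
  with assms have "bij_betw \<tau> V V" by (simp add: Un_absorb1)
  with assms have \<tau>: "\<tau> permutes V"
    by (intro bij_imp_permutes) (auto simp: \<tau>_def)
  have "bij_betw ((\<circ>) \<tau>) {\<pi>. \<pi> permutes V - P} {\<sigma>. \<sigma> permutes V \<and> (\<forall>a\<in>P. \<sigma> a = g a)}"
  proof (rule bij_betw_byWitness[where f' = "(\<circ>) (inv \<tau>)"])
    show "\<forall>a\<in>{\<pi>. \<pi> permutes V - P}. inv \<tau> \<circ> (\<tau> \<circ> a) = a"
      using \<tau> by (simp add: o_assoc permutes_inv_o)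
    show "\<forall>a\<in>{\<sigma>. \<sigma> permutes V \<and> (\<forall>a\<in>P. \<sigma> a = g a)}. \<tau> \<circ> (inv \<tau> \<circ> a) = a"
      using \<tau> by (simp add: o_assoc permutes_inv_o)
    show "(\<circ>) \<tau> ` {\<pi>. \<pi> permutes V - P} \<subseteq> {\<sigma>. \<sigma> permutes V \<and> (\<forall>a\<in>P. \<sigma> a = g a)}"
    proof clarsimp
      fix \<pi> assume \<pi>: "\<pi> permutes V - P"
      have "\<tau> (\<pi> a) = g a" if "a \<in> P" for a
        using that permutes_not_in[OF \<pi>] by (auto simp: \<tau>_def)
      moreover have "\<tau> \<circ> \<pi> permutes V"
        using \<pi> \<tau> by (meson Diff_subset permutes_compose permutes_subset)
      ultimately show "\<tau> \<circ> \<pi> permutes V \<and> (\<forall>a\<in>P. \<tau> (\<pi> a) = g a)" by auto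
    qed
    show "(\<circ>) (inv \<tau>) ` {\<sigma>. \<sigma> permutes V \<and> (\<forall>a\<in>P. \<sigma> a = g a)} \<subseteq> {\<pi>. \<pi> permutes V - P}"
    proof clarsimp
      fix \<sigma> assume \<sigma>: "\<sigma> permutes V" "\<forall>a\<in>P. \<sigma> a = g a"
      have "inv \<tau> \<circ> \<sigma> permutes V"
        using \<sigma> \<tau> by (simp add: permutes_compose permutes_inv)
      moreover have "(inv \<tau> \<circ> \<sigma>) a = a" if "a \<in> P" for a
        using that \<sigma> \<tau> by (auto simp: \<tau>_def permutes_inv_eq)
      ultimately show "inv \<tau> \<circ> \<sigma> permutes V - P"
        by (rule permutes_superset) auto
    qed
  qed
  then have "card {\<sigma>. \<sigma> permutes V \<and> (\<forall>a\<in>P. \<sigma> a = g a)} = card {\<pi>. \<pi> permutes V - P}"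
    by (simp add: bij_betw_same_card)
  also have "\<dots> = fact (card V - card P)"
    using assms by (subst card_permutations[OF refl]) (auto simp: card_Diff_subset finite_subset)
  finally show ?thesis .
qed

text \<open>Vertices \<open>V\<close> lie in columns given by \<open>col\<close>. The columns in
  \<open>R\<close> are roots; every other column that occurs has its outgoing edge either fixed in
  advance, in \<open>G\<close>, or determined by the image of its one vertex in \<open>L\<close>.
  This is general enough for both rows: row 1 uses the arrows as \<open>G\<close>, row 2 has
  \<open>G\<close> empty.\<close>

locale forest_count =
  fixes V L :: "'v set" and col :: "'v \<Rightarrow> 'n" and G :: "('n \<times> 'n) set" and R :: "'n set"
  assumes finite_V: "finite V"
    and L_subset: "L \<subseteq> V"
    and inj_col: "inj_on col L"
    and finite_G: "finite G"
    and single_valued_G: "single_valued G"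
    and G_disjoint: "Domain G \<inter> col ` L = {}"
    and R_disjoint: "R \<inter> (Domain G \<union> col ` L) = {}"
    and sinks: "col ` V \<union> Range G \<subseteq> R \<union> Domain G \<union> col ` L"
begin

text \<open>The part of the functional graph that is known once \<open>g\<close> is revealed on
  \<open>P\<close>. Vertices of \<open>P\<close> outside \<open>L\<close> give no edge, but they
  still use up an image.\<close>

definition edges :: "('v \<Rightarrow> 'v) \<Rightarrow> 'v set \<Rightarrow> ('n \<times> 'n) set" where
  "edges g P = G \<union> (\<lambda>a. (col a, col (g a))) ` (L \<inter> P)"

lemma edges_cong: "(\<And>a. a \<in> L \<inter> P \<Longrightarrow> g a = h a) \<Longrightarrow> edges g P = edges h P"
  unfolding edges_def by (metis (no_types, lifting) image_cong)

lemma edges_all: "L \<subseteq> P \<Longrightarrow> edges g P = edges g V"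
  using L_subset by (simp add: edges_def Int_absorb1 Int_absorb2)

lemma finite_edges: "finite (edges g P)"
  using finite_G finite_V L_subset by (auto simp: edges_def intro: finite_subset)

lemma Domain_edges: "Domain (edges g P) = Domain G \<union> col ` (L \<inter> P)"
  by (force simp: edges_def)

lemma single_valued_edges: "single_valued (edges g P)"
  using single_valued_G G_disjoint inj_col
  unfolding edges_def single_valued_def inj_on_def by fast

lemma edges_insert:
  "c \<in> L \<Longrightarrow> c \<notin> P \<Longrightarrow> edges (g(c := v)) (insert c P) = insert (col c, col v) (edges g P)"
  unfolding edges_def by (auto simp: image_iff)

text \<open>A sink that is not a root can only be the column of a vertex of \<open>L\<close> that is
  still unrevealed, since all other columns have an outgoing edge.\<close>

lemma reaches_R_or_free:
  assumes "g ` P \<subseteq> V" "acyclic (edges g P)" "b \<in> V"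
  obtains z where "(col b, z) \<in> (edges g P)\<^sup>*" "z \<in> R \<union> col ` (L - P)"
proof -
  obtain z where z: "(col b, z) \<in> (edges g P)\<^sup>*" "z \<notin> Domain (edges g P)"
    using acyclic_reaches_sink[OF finite_edges assms(2)] .
  from z(1) have "z \<in> R \<union> Domain G \<union> col ` L"
  proof (cases rule: rtranclE)
    case base
    with assms sinks show ?thesis by blast
  next
    case (step y)
    then have "z \<in> col ` V \<union> Range G"
      using assms by (auto simp: edges_def)
    with sinks show ?thesis by blast
  qed
  with z(2) have "z \<in> R \<union> col ` (L - P)" unfolding Domain_edges by auto
  with z that show thesis by blast
qed

text \<open>One further vertex \<open>c\<close> of \<open>L\<close> is revealed. Among the available
  vertices \<open>B\<close>, let \<open>X\<close> be those connected to a root and \<open>Y\<close>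
  those leading to the column of \<open>c\<close>. An image in \<open>Y\<close> closes a cycle; an
  image in \<open>X\<close> joins \<open>Y\<close> to a root and is itself used up, leaving |X| +
  |Y| - 1 connected vertices; any other image leaves \<open>X\<close> unchanged. The average over
  \<open>B\<close> preserves the proportion |X| / |B|, and once all of \<open>L\<close> is revealed
  every vertex is connected to a root.\<close>

theorem card_forests:
  assumes "P \<subseteq> V" "inj_on g P" "g ` P \<subseteq> V" "acyclic (edges g P)" "card P < card V"
  shows "card {\<sigma>. \<sigma> permutes V \<and> (\<forall>a\<in>P. \<sigma> a = g a) \<and> acyclic (edges \<sigma> V)} =
    card {b \<in> V - g ` P. \<exists>z\<in>R. (col b, z) \<in> (edges g P)\<^sup>*} * fact (card V - card P - 1)"
  using assms
proof (induction "card (L - P)" arbitrary: P g)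
  case 0
  have finP: "finite P" using 0 finite_V finite_subset by blast
  have "L \<subseteq> P" using 0 finite_V L_subset by (metis Diff_eq_empty_iff card_0_eq finite_Diff finite_subset)
  have "acyclic (edges \<sigma> V)" if "\<forall>a\<in>P. \<sigma> a = g a" for \<sigma>
    using that edges_cong[of P \<sigma> g] edges_all[OF \<open>L \<subseteq> P\<close>] 0 by (metis Int_iff)
  then have "{\<sigma>. \<sigma> permutes V \<and> (\<forall>a\<in>P. \<sigma> a = g a) \<and> acyclic (edges \<sigma> V)} =
     {\<sigma>. \<sigma> permutes V \<and> (\<forall>a\<in>P. \<sigma> a = g a)}" by auto
  then have *: "card {\<sigma>. \<sigma> permutes V \<and> (\<forall>a\<in>P. \<sigma> a = g a) \<and> acyclic (edges \<sigma> V)} =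
      fact (card V - card P)"
    using card_permutations_extending[OF finite_V] 0 by simp
  have "\<exists>z\<in>R. (col b, z) \<in> (edges g P)\<^sup>*" if "b \<in> V" for b
    using reaches_R_or_free[OF 0(4,5) that] \<open>L \<subseteq> P\<close> by auto
  then have "{b \<in> V - g ` P. \<exists>z\<in>R. (col b, z) \<in> (edges g P)\<^sup>*} = V - g ` P" by auto
  moreover have "card (V - g ` P) = card V - card P"
    using 0 finP by (simp add: card_Diff_subset card_image)
  ultimately show ?case
    using * 0(6) by (simp add: fact_reduce)
next
  case (Suc n)
  have finP: "finite P" using Suc finite_V finite_subset by blast
  from Suc obtain c where c: "c \<in> L" "c \<notin> P"
    by (metis Diff_iff card.empty ex_in_conv nat.distinct(1))
  define B where "B = V - g ` P"
  define E where "E = edges g P"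
  define X where "X = {b \<in> B. \<exists>z\<in>R. (col b, z) \<in> E\<^sup>*}"
  define Y where "Y = {b \<in> B. (col b, col c) \<in> E\<^sup>*}"
  have finB: "finite B" using finite_V by (simp add: B_def)
  have cardB: "card B = card V - card P"
    unfolding B_def using Suc finP by (simp add: card_Diff_subset card_image)
  have cV: "c \<in> V" using c L_subset by auto
  have XB: "X \<subseteq> B" "Y \<subseteq> B" by (auto simp: X_def Y_def)
  have finX: "finite X" "finite Y" using XB finB finite_subset by auto
  have csink: "col c \<notin> Domain E"
    using c inj_col G_disjoint by (auto simp: E_def Domain_edges inj_on_def)
  have Rsink: "z \<notin> Domain E" if "z \<in> R" for z
    using that R_disjoint by (auto simp: E_def Domain_edges)
  have cR: "col c \<notin> R" using c R_disjoint by auto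
  have XY: "X \<inter> Y = {}"
    using sink_unique[OF single_valued_edges, folded E_def] csink Rsink cR
    unfolding X_def Y_def E_def by blast
  define N where "N v = {\<sigma>. \<sigma> permutes V \<and> (\<forall>a\<in>P. \<sigma> a = g a) \<and> acyclic (edges \<sigma> V) \<and> \<sigma> c = v}" for v
  have finN: "finite (N v)" for v
    by (rule finite_subset[OF _ finite_permutations[OF finite_V]]) (auto simp: N_def)
  have "{\<sigma>. \<sigma> permutes V \<and> (\<forall>a\<in>P. \<sigma> a = g a) \<and> acyclic (edges \<sigma> V)} = (\<Union>v\<in>B. N v)"
  proof -
    have "\<sigma> c \<in> B" if "\<sigma> permutes V" "\<forall>a\<in>P. \<sigma> a = g a" for \<sigma>
    proof -
      have "\<sigma> c \<in> V" using that cV by (simp add: permutes_in_image)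
      moreover have "\<sigma> c \<noteq> g a" if "a \<in> P" for a
        using that \<open>\<forall>a\<in>P. \<sigma> a = g a\<close> c permutes_inj[OF \<open>\<sigma> permutes V\<close>] by (metis injD)
      ultimately show ?thesis by (auto simp: B_def)
    qed
    then show ?thesis by (auto simp: N_def)
  qed
  then have total: "card {\<sigma>. \<sigma> permutes V \<and> (\<forall>a\<in>P. \<sigma> a = g a) \<and> acyclic (edges \<sigma> V)} = (\<Sum>v\<in>B. card (N v))"
    using finB finN by (subst card_UN_disjoint[symmetric]) (auto simp: N_def)
  have E': "edges (g(c := v)) (insert c P) = insert (col c, col v) E" for v
    unfolding E_def using c by (rule edges_insert)
  have N: "N v = {\<sigma>. \<sigma> permutes V \<and> (\<forall>a\<in>insert c P. \<sigma> a = (g(c := v)) a) \<and> acyclic (edges \<sigma> V)}" for v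
    using c by (auto simp: N_def)
  have acyc: "acyclic (edges (g(c := v)) (insert c P)) \<longleftrightarrow> v \<notin> Y" if "v \<in> B" for v
    using Suc that unfolding E' by (auto simp: Y_def E_def acyclic_insert)
  have im: "(g(c := v)) ` insert c P = insert v (g ` P)" for v using c by auto
  have inj: "inj_on (g(c := v)) (insert c P)" if "v \<in> B" for v
    using Suc c that by (auto simp: B_def inj_on_def)
  have N_empty: "N v = {}" if "v \<in> Y" for v
  proof -
    have "\<not> acyclic (edges \<sigma> V)" if "\<forall>a\<in>insert c P. \<sigma> a = (g(c := v)) a" for \<sigma>
    proof -
      have "edges (g(c := v)) (insert c P) = edges \<sigma> (insert c P)"
        using that by (intro edges_cong) auto
      also have "\<dots> \<subseteq> edges \<sigma> V"
        using L_subset by (auto simp: edges_def)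
      finally show ?thesis using acyc[of v] \<open>v \<in> Y\<close> XB acyclic_subset by blast
    qed
    then show ?thesis unfolding N by blast
  qed
  have X: "{b \<in> V - g ` P. \<exists>z\<in>R. (col b, z) \<in> (edges g P)\<^sup>*} = X"
    by (simp add: X_def B_def E_def)
  have "card {\<sigma>. \<sigma> permutes V \<and> (\<forall>a\<in>P. \<sigma> a = g a) \<and> acyclic (edges \<sigma> V)} =
    card X * fact (card V - card P - 1)"
  proof (cases "card B = 1")
    \<comment> \<open>With a single available vertex, revealing \<open>c\<close> exhausts
      \<open>V\<close>, and the induction hypothesis, which requires a vertex outside the prescribed
      set, does not apply.\<close>
    case True
    then obtain v where B1: "B = {v}" by (metis card_1_singletonE)
    have m: "card V = Suc (card P)" using True cardB by simp
    have PV: "insert c P = V"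
      using Suc c cV finP finite_V m by (intro card_subset_eq) auto
    have "L - P = {c}" using PV c L_subset by auto
    have "v \<in> V" using B1 by (auto simp: B_def)
    then obtain z where z: "(col v, z) \<in> E\<^sup>*" "z \<in> R \<union> {col c}"
      using reaches_R_or_free[OF Suc.prems(3,4), of v] \<open>L - P = {c}\<close> by (auto simp: E_def)
    show ?thesis
    proof (cases "v \<in> Y")
      case True
      then have "X = {}" using B1 XB XY by auto
      with True N_empty total show ?thesis by (simp add: B1)
    next
      case False
      then have "z \<in> R" using z B1 by (auto simp: Y_def)
      then have X1: "X = {v}" using z B1 by (auto simp: X_def)
      have "acyclic (edges \<sigma> V)" if "\<forall>a\<in>insert c P. \<sigma> a = (g(c := v)) a" for \<sigma>
        using that edges_cong[of V \<sigma> "g(c := v)"] False acyc[of v] B1 PV by auto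
      then have "N v = {\<sigma>. \<sigma> permutes V \<and> (\<forall>a\<in>insert c P. \<sigma> a = (g(c := v)) a)}"
        unfolding N by blast
      moreover have "(g(c := v)) ` insert c P \<subseteq> V"
        unfolding im using Suc.prems(3) \<open>v \<in> V\<close> by auto
      ultimately have "card (N v) = fact (card V - card (insert c P))"
        using card_permutations_extending[OF finite_V _ inj] PV B1 by simp
      then have "card (N v) = 1" using PV by simp
      with total X1 m show ?thesis by (simp add: B1)
    qed
  next
    case False
    have *: "card V - card P - 1 = Suc (card V - card P - 2)"
      using False Suc.prems(5) cardB by simp
    have "card (N v) = (if v \<in> X then card X + card Y - 1 else if v \<in> Y then 0 else card X)
        * fact (card V - card P - 2)" if v: "v \<in> B" for v
    proof (cases "v \<in> Y")
      case True
      with XY N_empty show ?thesis by auto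
    next
      case notY: False
      define g' where "g' = g(c := v)"
      have "(col b, z) \<in> (edges g' (insert c P))\<^sup>* \<longleftrightarrow>
            (col b, z) \<in> E\<^sup>* \<or> (col b, col c) \<in> E\<^sup>* \<and> (col v, z) \<in> E\<^sup>*" for b z
        unfolding g'_def E' rtrancl_insert by auto
      then have "{b \<in> V - g' ` insert c P. \<exists>z\<in>R. (col b, z) \<in> (edges g' (insert c P))\<^sup>*} =
            (if v \<in> X then (X \<union> Y) - {v} else X)"
        using v unfolding g'_def im by (auto simp: X_def Y_def B_def)
      then have W: "card {b \<in> V - g' ` insert c P. \<exists>z\<in>R. (col b, z) \<in> (edges g' (insert c P))\<^sup>*} =
            (if v \<in> X then card X + card Y - 1 else card X)"
        using finX XY by (simp add: card_Diff_singleton card_Un_disjoint)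
      have "card (N v) = card {b \<in> V - g' ` insert c P. \<exists>z\<in>R. (col b, z) \<in> (edges g' (insert c P))\<^sup>*}
         * fact (card V - card (insert c P) - 1)"
        unfolding N g'_def
      proof (rule Suc.hyps(1))
        have "L - insert c P = (L - P) - {c}" by auto
        then show "n = card (L - insert c P)"
          using Suc.hyps(2) c finite_V L_subset finite_subset[OF L_subset] by (simp add: card_Diff_singleton)
        show "inj_on (g(c := v)) (insert c P)" using v by (rule inj)
        show "(g(c := v)) ` insert c P \<subseteq> V" using Suc v unfolding im by (auto simp: B_def)
        show "insert c P \<subseteq> V" using Suc cV by auto
        show "acyclic (edges (g(c := v)) (insert c P))" using acyc v notY by simp
        show "card (insert c P) < card V" using * c finP by simp
      qed
      with W notY c finP show ?thesis by simp
    qed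
    with total have "card {\<sigma>. \<sigma> permutes V \<and> (\<forall>a\<in>P. \<sigma> a = g a) \<and> acyclic (edges \<sigma> V)} =
      (\<Sum>v\<in>B. (if v \<in> X then card X + card Y - 1 else if v \<in> Y then 0 else card X)
        * fact (card V - card P - 2))" by simp
    also have "\<dots> = (card X * (card X + card Y - 1) + card (B - X - Y) * card X)
        * fact (card V - card P - 2)"
    proof -
      have "(\<Sum>v\<in>B. f v) = (\<Sum>v\<in>B - X - Y. f v) + (\<Sum>v\<in>Y. f v) + (\<Sum>v\<in>X. f v)" for f :: "'v \<Rightarrow> nat"
        using sum.subset_diff[OF XB(1) finB, of f] sum.subset_diff[of Y "B - X" f] XB XY finB by auto
      moreover have "(\<Sum>v\<in>Y. (if v \<in> X then card X + card Y - 1 else if v \<in> Y then 0 else card X)) = 0"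
        using XY by (intro sum.neutral) auto
      ultimately show ?thesis
        by (simp add: sum_distrib_right[symmetric])
    qed
    \<comment> \<open>The size of \<open>Y\<close> cancels. Empty \<open>X\<close> is treated apart
      because the subtraction of 1 is truncated.\<close>
    also have "card X * (card X + card Y - 1) + card (B - X - Y) * card X = card X * (card B - 1)"
    proof (cases "card X = 0")
      case nonzero: False
      have "card B = card (X \<union> Y) + card (B - (X \<union> Y))"
        using card_Un_disjoint[of "X \<union> Y" "B - (X \<union> Y)"] XB finB finX
        by (auto simp: Un_absorb1)
      then have "card B = card X + card Y + card (B - X - Y)"
        using finX XY by (simp add: card_Un_disjoint Diff_eq Int_assoc)
      then have "card B - 1 = (card X + card Y - 1) + card (B - X - Y)"
        using nonzero by linarith
      then show ?thesis by (simp add: algebra_simps)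
    qed simp
    also have "\<dots> * fact (card V - card P - 2) = card X * fact (card V - card P - 1)"
      using * cardB by (simp add: algebra_simps)
    finally show ?thesis .
  qed
  then show ?case unfolding X .
qed

end

section \<open>The grid of an irreducible substructure\<close>

text \<open>Both rows have the same cell sizes, so one vertex set serves for both and a pairing is a
  permutation of it. Positivity of \<open>w\<close> gives every column a rightmost vertex;
  irreducibility enters as the condition that arrows end in columns that are neither marked nor
  tails, which are the critical columns \<open>C\<close>.\<close>

locale irreducible_grid =
  fixes K :: nat and w :: "nat \<Rightarrow> nat" and \<R> :: "nat set" and \<phi> :: "nat \<rightharpoonup> nat"
  assumes w_pos: "j \<in> {1..K} \<Longrightarrow> w j > 0"
    and R_nonempty: "\<R> \<noteq> {}"
    and R_subset: "\<R> \<subseteq> {1..K}"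
    and dom_phi: "dom \<phi> \<subseteq> {1..K} - \<R>"
    and ran_phi: "ran \<phi> \<subseteq> {1..K} - \<R> - dom \<phi>"
begin

definition C :: "nat set" where "C = {1..K} - \<R> - dom \<phi>"

abbreviation V :: "vertex set" where "V \<equiv> vertices K w"

abbreviation lst :: "nat \<Rightarrow> vertex" where "lst \<equiv> rightmost w"

lemma fst_lst [simp]: "fst (lst j) = j"
  by (simp add: rightmost_def)

lemma lst_eq_iff [simp]: "lst j = lst k \<longleftrightarrow> j = k"
  by (auto simp: rightmost_def)

lemma inj_lst: "inj_on lst A"
  by (auto simp: inj_on_def)

lemma fst_in_columns: "v \<in> V \<Longrightarrow> fst v \<in> {1..K}"
  by (auto simp: vertices_def)

lemma lst_in_V [simp]: "lst j \<in> V \<longleftrightarrow> j \<in> {1..K}"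
  using w_pos[of j] by (auto simp: vertices_def rightmost_def Suc_le_eq)

lemma finite_V: "finite V"
  by (simp add: vertices_def)

lemma C_subset: "C \<subseteq> {1..K}" and finite_C: "finite C"
  by (auto simp: C_def)

lemma finite_graph_phi: "finite (Map.graph \<phi>)"
  using finite_subset[OF dom_phi] by (simp add: finite_graph_iff_finite_dom)

lemma Domain_graph_phi: "Domain (Map.graph \<phi>) = dom \<phi>"
  by (auto simp: Map.graph_def)

lemma Range_graph_phi: "Range (Map.graph \<phi>) \<subseteq> C"
  using ran_phi by (auto simp: Map.graph_def C_def ran_def)

lemma acyclic_graph_phi: "acyclic (Map.graph \<phi>)"
proof (rule acyclicI, rule allI, rule notI)
  fix a assume "(a, a) \<in> (Map.graph \<phi>)\<^sup>+"
  then have "a \<in> Domain (Map.graph \<phi>)" "a \<in> Range (Map.graph \<phi>)"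
    by (meson DomainI tranclD, meson RangeI tranclD2)
  then have "a \<in> dom \<phi>" "a \<in> C"
    unfolding Domain_graph_phi using Range_graph_phi by auto
  then show False by (simp add: C_def)
qed

lemma single_valued_graph_phi: "single_valued (Map.graph \<phi>)"
  by (auto simp: Map.graph_def single_valued_def)

sublocale row1: forest_count V "lst ` C" fst "Map.graph \<phi>" \<R>
proof
  show "finite V" by (rule finite_V)
  show "lst ` C \<subseteq> V" using C_subset by auto
  show "inj_on fst (lst ` C)" by (auto simp: inj_on_def)
  show "finite (Map.graph \<phi>)" by (rule finite_graph_phi)
  show "single_valued (Map.graph \<phi>)" by (rule single_valued_graph_phi)
  show "Domain (Map.graph \<phi>) \<inter> fst ` lst ` C = {}"
    by (auto simp: Domain_graph_phi image_image C_def)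
  show "\<R> \<inter> (Domain (Map.graph \<phi>) \<union> fst ` lst ` C) = {}"
    unfolding Domain_graph_phi using dom_phi by (auto simp: image_image C_def)
  show "fst ` V \<union> Range (Map.graph \<phi>) \<subseteq> \<R> \<union> Domain (Map.graph \<phi>) \<union> fst ` lst ` C"
    unfolding Domain_graph_phi
    using Range_graph_phi fst_in_columns by (auto simp: image_image C_def)
qed

text \<open>A lemma and not a sublocale, since the unmarked set \<open>U\<close> varies. Row 2
  follows partners backwards, so this instance is applied to the inverse of the pairing
  permutation.\<close>

lemma row2: "U \<subseteq> {1..K} \<Longrightarrow> forest_count V (lst ` U) fst {} ({1..K} - U)"
  using fst_in_columns by unfold_locales (auto simp: finite_V inj_on_def image_image)

section \<open>Pairs of forests given by one permutation and its inverse\<close>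

abbreviation edges2 :: "nat set \<Rightarrow> (vertex \<Rightarrow> vertex) \<Rightarrow> vertex set \<Rightarrow> (nat \<times> nat) set" where
  "edges2 U \<equiv> forest_count.edges (lst ` U) fst {}"

definition good1 :: "(vertex \<Rightarrow> vertex) set" where
  "good1 = {\<sigma>. \<sigma> permutes V \<and> acyclic (row1.edges \<sigma> V)}"

definition good2 :: "nat set \<Rightarrow> (vertex \<Rightarrow> vertex) set" where
  "good2 U = {\<sigma>. \<sigma> permutes V \<and> acyclic (edges2 U (inv \<sigma>) V)}"

text \<open>With the partners of the critical vertices revealed, the vertices still available as
  images under \<open>inv \<sigma>\<close> are the noncritical ones. Those collected here are
  connected to a row-2 root, as in the count of \<open>card_forests\<close>.\<close>

definition escaping :: "nat set \<Rightarrow> (vertex \<Rightarrow> vertex) \<Rightarrow> vertex set" where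
  "escaping U \<sigma> = {y \<in> V - lst ` C. \<exists>z\<in>{1..K} - U. (fst y, z) \<in> (edges2 U (inv \<sigma>) (\<sigma> ` lst ` C))\<^sup>*}"

lemma finite_good1: "finite good1"
  by (rule finite_subset[OF _ finite_permutations[OF finite_V]]) (auto simp: good1_def)

lemma edges1_iff:
  "(j, k) \<in> row1.edges \<sigma> V \<longleftrightarrow> \<phi> j = Some k \<or> j \<in> C \<and> k = fst (\<sigma> (lst j))"
  unfolding row1.edges_def Int_absorb2[OF row1.L_subset]
  by (auto simp: Map.graph_def image_image)

text \<open>A row-2 edge out of column j becomes known exactly when its last vertex is the partner
  of the last vertex of a critical column k. Row 1 then has the edge from k to j, the reverse of the
  new one.\<close>

lemma edges2_iff:
  assumes "\<sigma> permutes V" "U \<subseteq> {1..K}"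
  shows "(j, k) \<in> edges2 U (inv \<sigma>) (\<sigma> ` lst ` C) \<longleftrightarrow> j \<in> U \<and> k \<in> C \<and> \<sigma> (lst k) = lst j"
proof -
  have *: "inv \<sigma> (lst j) = lst k \<longleftrightarrow> \<sigma> (lst k) = lst j" for j k
    using permutes_inv_eq[OF assms(1)] .
  have "edges2 U (inv \<sigma>) (\<sigma> ` lst ` C) = (\<lambda>a. (fst a, fst (inv \<sigma> a))) ` (lst ` U \<inter> \<sigma> ` lst ` C)"
    by (simp add: forest_count.edges_def[OF row2[OF assms(2)]])
  also have "\<dots> = {(j, k). j \<in> U \<and> k \<in> C \<and> \<sigma> (lst k) = lst j}"
  proof (intro equalityI subsetI)
    fix e assume "e \<in> (\<lambda>a. (fst a, fst (inv \<sigma> a))) ` (lst ` U \<inter> \<sigma> ` lst ` C)"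
    then obtain u c where "u \<in> U" "c \<in> C" "lst u = \<sigma> (lst c)" "e = (u, fst (inv \<sigma> (lst u)))"
      by auto
    then show "e \<in> {(j, k). j \<in> U \<and> k \<in> C \<and> \<sigma> (lst k) = lst j}"
      using *[of u c] by auto
  next
    fix e assume "e \<in> {(j, k). j \<in> U \<and> k \<in> C \<and> \<sigma> (lst k) = lst j}"
    then obtain u c where e: "u \<in> U" "c \<in> C" "\<sigma> (lst c) = lst u" "e = (u, c)" by auto
    then have "e = (fst (lst u), fst (inv \<sigma> (lst u)))" using *[of u c] by simp
    moreover have "lst u \<in> lst ` U \<inter> \<sigma> ` lst ` C"
      using e by (metis IntI imageI)
    ultimately show "e \<in> (\<lambda>a. (fst a, fst (inv \<sigma> a))) ` (lst ` U \<inter> \<sigma> ` lst ` C)"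
      by (rule image_eqI)
  qed
  finally show ?thesis by auto
qed

lemma card_lst: "card (lst ` A) = card A"
  by (simp add: card_image inj_lst)

text \<open>The last vertex of a marked column is not critical. The strict inequality is what later
  permits cancelling the factor \<open>card V - card C\<close>.\<close>

lemma card_C_less: "card C < card V"
proof -
  obtain j where "j \<in> \<R>" using R_nonempty by auto
  then have "lst j \<in> V - lst ` C" using R_subset by (auto simp: C_def)
  then have "lst ` C \<subset> V" using row1.L_subset by blast
  then show ?thesis using psubset_card_mono[OF finite_V] card_lst by metis
qed

text \<open>
  Double counting of the pairs of permutations that agree on the critical vertices of row 1.
  The edges of row 2 known from this agreement reverse edges of row 1, hence are acyclic.
\<close>

lemma good_pairs_count:
  assumes U: "U \<subseteq> {1..K}"
  shows "card (good1 \<inter> good2 U) * (card V - card C) = (\<Sum>\<sigma>\<in>good1. card (escaping U \<sigma>))"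
proof -
  interpret row2: forest_count V "lst ` U" fst "{}" "{1..K} - U"
    using U by (rule row2)
  let ?m = "card V - card C"
  let ?agree = "\<lambda>\<tau> \<sigma>. \<forall>a\<in>lst ` C. \<sigma> a = (\<tau> :: vertex \<Rightarrow> vertex) a"
  have CV: "lst ` C \<subseteq> V" using C_subset by auto
  have agree_good1: "\<sigma> \<in> good1" if "\<tau> \<in> good1" "\<sigma> permutes V" "?agree \<tau> \<sigma>" for \<sigma> \<tau>
  proof -
    have "row1.edges \<sigma> V = row1.edges \<tau> V"
      using that(3) by (intro row1.edges_cong) blast
    with that show ?thesis by (simp add: good1_def)
  qed
  have "card {\<sigma> \<in> good1 \<inter> good2 U. ?agree \<tau> \<sigma>} = card (escaping U \<tau>) * fact (?m - 1)"
    if \<tau>: "\<tau> \<in> good1" for \<tau>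
  proof -
    let ?P = "\<tau> ` lst ` C"
    have perm: "\<tau> permutes V" using \<tau> by (simp add: good1_def)
    have PV: "?P \<subseteq> V" using CV perm by (metis image_mono permutes_image)
    have cardP: "card ?P = card C"
      using perm by (metis card_image card_lst inj_on_subset permutes_inj subset_UNIV)
    have inv_P: "inv \<tau> ` ?P = lst ` C"
      using perm by (simp add: image_image permutes_inverses)
    have "edges2 U (inv \<tau>) ?P \<subseteq> (row1.edges \<tau> V)\<inverse>"
      by (auto simp: edges2_iff[OF perm U] edges1_iff)
    moreover have "acyclic ((row1.edges \<tau> V)\<inverse>)"
      using \<tau> by (simp add: good1_def)
    ultimately have acyc: "acyclic (edges2 U (inv \<tau>) ?P)" using acyclic_subset by blast
    \<comment> \<open>Agreement with \<tau> on the critical vertices means that the inverses agree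
      on the images of these vertices, so inversion turns the set into one with prescribed
      values.\<close>
    have "bij_betw inv {\<sigma> \<in> good1 \<inter> good2 U. ?agree \<tau> \<sigma>}
       {\<rho>. \<rho> permutes V \<and> (\<forall>a\<in>?P. \<rho> a = inv \<tau> a) \<and> acyclic (edges2 U \<rho> V)}"
    proof (rule bij_betw_byWitness[where f' = inv])
      show "\<forall>a\<in>{\<sigma> \<in> good1 \<inter> good2 U. ?agree \<tau> \<sigma>}. inv (inv a) = a"
        by (auto simp: good1_def permutes_inv_inv)
      show "\<forall>a'\<in>{\<rho>. \<rho> permutes V \<and> (\<forall>a\<in>?P. \<rho> a = inv \<tau> a) \<and> acyclic (edges2 U \<rho> V)}. inv (inv a') = a'"
        by (auto simp: permutes_inv_inv)
      show "inv ` {\<sigma> \<in> good1 \<inter> good2 U. ?agree \<tau> \<sigma>} \<subseteq>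
        {\<rho>. \<rho> permutes V \<and> (\<forall>a\<in>?P. \<rho> a = inv \<tau> a) \<and> acyclic (edges2 U \<rho> V)}"
      proof clarify
        fix \<sigma> assume \<sigma>: "\<sigma> \<in> good1" "\<sigma> \<in> good2 U" "?agree \<tau> \<sigma>"
        then have s: "\<sigma> permutes V" by (simp add: good1_def)
        have "inv \<sigma> (\<tau> (lst c)) = inv \<tau> (\<tau> (lst c))" if "c \<in> C" for c
          using \<sigma>(3) that permutes_inverses(2)[OF s] permutes_inverses(2)[OF perm]
          by (metis imageI)
        then show "inv \<sigma> permutes V \<and> (\<forall>a\<in>?P. inv \<sigma> a = inv \<tau> a) \<and> acyclic (edges2 U (inv \<sigma>) V)"
          using s \<sigma> by (auto simp: good2_def permutes_inv)
      qed
      show "inv ` {\<rho>. \<rho> permutes V \<and> (\<forall>a\<in>?P. \<rho> a = inv \<tau> a) \<and> acyclic (edges2 U \<rho> V)} \<subseteq>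
        {\<sigma> \<in> good1 \<inter> good2 U. ?agree \<tau> \<sigma>}"
      proof clarify
        fix \<rho> assume \<rho>: "\<rho> permutes V" "\<forall>a\<in>?P. \<rho> a = inv \<tau> a" "acyclic (edges2 U \<rho> V)"
        have "inv \<rho> (lst c) = \<tau> (lst c)" if "c \<in> C" for c
          using \<rho>(1,2) that permutes_inverses(2)[OF perm]
          by (auto simp: permutes_inv_eq[OF \<rho>(1)])
        then have "?agree \<tau> (inv \<rho>)" by auto
        moreover from this have "inv \<rho> \<in> good1"
          using agree_good1 \<tau> \<rho> by (simp add: permutes_inv)
        moreover have "inv \<rho> \<in> good2 U"
          using \<rho> by (auto simp: good2_def permutes_inv permutes_inv_inv)
        ultimately show "inv \<rho> \<in> good1 \<inter> good2 U \<and> ?agree \<tau> (inv \<rho>)" by auto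
      qed
    qed
    then have "card {\<sigma> \<in> good1 \<inter> good2 U. ?agree \<tau> \<sigma>} =
      card {\<rho>. \<rho> permutes V \<and> (\<forall>a\<in>?P. \<rho> a = inv \<tau> a) \<and> acyclic (edges2 U \<rho> V)}"
      by (rule bij_betw_same_card)
    also have "\<dots> = card {b \<in> V - inv \<tau> ` ?P. \<exists>z\<in>{1..K} - U. (fst b, z) \<in> (edges2 U (inv \<tau>) ?P)\<^sup>*}
       * fact (card V - card ?P - 1)"
    proof (rule row2.card_forests[OF PV _ _ acyc])
      show "inj_on (inv \<tau>) ?P" using perm by (metis inj_on_subset permutes_inj permutes_inv subset_UNIV)
      show "inv \<tau> ` ?P \<subseteq> V" using CV inv_P by simp
      show "card ?P < card V" using cardP card_C_less by simp
    qed
    finally show ?thesis by (simp add: cardP inv_P escaping_def)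
  qed
  then have "(\<Sum>\<tau>\<in>good1. card (escaping U \<tau>)) * fact (?m - 1) =
     (\<Sum>\<tau>\<in>good1. card {\<sigma> \<in> good1 \<inter> good2 U. ?agree \<tau> \<sigma>})"
    by (simp add: sum_distrib_right)
  \<comment> \<open>Counted from the other side: the edges of row 1 depend only on the critical
    vertices, so every permutation agreeing with \<sigma> there is in \<open>good1\<close>, and
    there are ?m! of them. Against the (?m - 1)! from the first count this leaves the factor
    ?m.\<close>
  also have "\<dots> = (\<Sum>\<sigma>\<in>good1 \<inter> good2 U. fact ?m)"
  proof (rule sum_multicount_gen)
    show "\<forall>\<sigma>\<in>good1 \<inter> good2 U. card {\<tau> \<in> good1. ?agree \<tau> \<sigma>} = fact ?m"
    proof
      fix \<sigma> assume \<sigma>: "\<sigma> \<in> good1 \<inter> good2 U"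
      then have s: "\<sigma> permutes V" by (simp add: good1_def)
      have "{\<tau> \<in> good1. ?agree \<tau> \<sigma>} = {\<tau>. \<tau> permutes V \<and> (\<forall>a\<in>lst ` C. \<tau> a = \<sigma> a)}"
        using \<sigma> agree_good1[of \<sigma>] by (auto simp: good1_def)
      moreover have "\<sigma> ` lst ` C \<subseteq> V" using CV s by (metis image_mono permutes_image)
      moreover have "inj_on \<sigma> (lst ` C)" using s by (metis inj_on_subset permutes_inj subset_UNIV)
      ultimately show "card {\<tau> \<in> good1. ?agree \<tau> \<sigma>} = fact ?m"
        using card_permutations_extending[OF finite_V CV] by (simp add: card_lst)
    qed
  qed (auto simp: finite_good1)
  also have "\<dots> = card (good1 \<inter> good2 U) * ?m * fact (?m - 1)"
    using card_C_less by (simp add: fact_reduce)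
  finally show ?thesis by simp
qed

section \<open>Paths leaving the unmarked columns\<close>

text \<open>The list holds the columns visited after \<open>j\<close> along known row-2 edges, up to
  the first column outside \<open>U\<close>.\<close>

fun path :: "nat set \<Rightarrow> (vertex \<Rightarrow> vertex) \<Rightarrow> nat \<Rightarrow> nat list \<Rightarrow> bool" where
  "path U \<sigma> j [] \<longleftrightarrow> j \<notin> U"
| "path U \<sigma> j (c # cs) \<longleftrightarrow> j \<in> U \<and> c \<in> C \<and> \<sigma> (lst c) = lst j \<and> path U \<sigma> c cs"

text \<open>The part of \<open>path\<close> that concerns \<sigma> alone. Separating it from the
  conditions on \<open>U\<close> allows the sums over \<sigma> and over \<open>U\<close> to be
  evaluated independently.\<close>

fun chain :: "(vertex \<Rightarrow> vertex) \<Rightarrow> nat \<Rightarrow> nat list \<Rightarrow> bool" where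
  "chain \<sigma> j [] \<longleftrightarrow> True"
| "chain \<sigma> j (c # cs) \<longleftrightarrow> \<sigma> (lst c) = lst j \<and> chain \<sigma> c cs"

text \<open>On a distinct list, the element preceding a given one in \<open>j # xs\<close>: a chain
  prescribes the last vertex of that column as the image of the last vertex of the given
  column.\<close>

fun pred_in :: "nat \<Rightarrow> nat list \<Rightarrow> nat \<Rightarrow> nat" where
  "pred_in j [] = id"
| "pred_in j (c # cs) = (pred_in c cs)(c := j)"

text \<open>The row-1 edges forced by the arrows and the chain. They run along the list towards its
  start \<open>j\<close>, against the direction of the path.\<close>

definition chain_edges :: "nat \<Rightarrow> nat list \<Rightarrow> (nat \<times> nat) set" where
  "chain_edges j xs = Map.graph \<phi> \<union> (\<lambda>c. (c, pred_in j xs c)) ` set xs"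

lemma path_iff:
  "path U \<sigma> j xs \<longleftrightarrow>
     chain \<sigma> j xs \<and> set xs \<subseteq> C \<and> set (butlast (j # xs)) \<subseteq> U \<and> last (j # xs) \<notin> U"
  by (induction xs arbitrary: j) auto

lemma chain_edges_Nil [simp]: "chain_edges j [] = Map.graph \<phi>"
  by (simp add: chain_edges_def)

lemma chain_edges_Cons:
  assumes "c \<notin> set cs"
  shows "chain_edges j (c # cs) = insert (c, j) (chain_edges c cs)"
proof -
  have "(\<lambda>a. (a, pred_in j (c # cs) a)) ` set cs = (\<lambda>a. (a, pred_in c cs a)) ` set cs"
    using assms by (intro image_cong) auto
  then show ?thesis by (simp add: chain_edges_def)
qed

lemma Domain_chain_edges: "Domain (chain_edges j xs) = dom \<phi> \<union> set xs"
  unfolding chain_edges_def Domain_Un_eq Domain_graph_phi by auto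

lemma Range_chain_edges:
  "distinct xs \<Longrightarrow> set xs \<subseteq> C \<Longrightarrow> Range (chain_edges j xs) \<subseteq> insert j C"
  using Range_graph_phi by (induction xs arbitrary: j) (auto simp: chain_edges_Cons)

text \<open>The edges are added from the far end of the list. The new target \<open>j\<close> is
  critical and outside the rest of the list, so it has no outgoing edge yet and no cycle is
  closed.\<close>

lemma acyclic_chain_edges:
  assumes "distinct (j # xs)" "set (j # xs) \<subseteq> C"
  shows "acyclic (chain_edges j xs)"
  using assms
proof (induction xs arbitrary: j)
  case Nil
  show ?case by (simp add: acyclic_graph_phi)
next
  case (Cons c cs)
  have "j \<notin> Domain (chain_edges c cs)"
    using Cons.prems by (auto simp: Domain_chain_edges C_def)
  then have "(j, c) \<notin> (chain_edges c cs)\<^sup>*"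
    using Cons.prems by (metis Domain.DomainI converse_rtranclE distinct_length_2_or_more)
  with Cons show ?case by (simp add: chain_edges_Cons acyclic_insert)
qed

lemma chain_edges_reach:
  assumes "distinct xs" "a \<in> set xs"
  shows "(a, j) \<in> (chain_edges j xs)\<^sup>*"
  using assms
proof (induction xs arbitrary: j a)
  case (Cons c cs)
  have *: "(chain_edges c cs)\<^sup>* \<subseteq> (chain_edges j (c # cs))\<^sup>*" "(c, j) \<in> chain_edges j (c # cs)"
    using Cons.prems by (auto simp: chain_edges_Cons intro!: rtrancl_mono)
  have "(a, c) \<in> (chain_edges j (c # cs))\<^sup>*"
    using Cons * by (cases "a = c") auto
  with *(2) show ?case by simp
qed simp

lemma chain_iff_pred_in:
  "distinct xs \<Longrightarrow> chain \<sigma> j xs \<longleftrightarrow> (\<forall>c\<in>set xs. \<sigma> (lst c) = lst (pred_in j xs c))"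
proof (induction xs arbitrary: j)
  case (Cons c cs)
  then show ?case by (auto split: if_splits)
qed simp

lemma chain_edges_subset:
  assumes "distinct xs" "set xs \<subseteq> C" "chain \<sigma> j xs"
  shows "chain_edges j xs \<subseteq> row1.edges \<sigma> V"
proof (rule subrelI)
  fix a b assume "(a, b) \<in> chain_edges j xs"
  then show "(a, b) \<in> row1.edges \<sigma> V"
    using assms unfolding edges1_iff by (auto simp: chain_edges_def chain_iff_pred_in Map.graph_def)
qed

text \<open>All columns of \<open>c # cs\<close> lead to \<open>c\<close> in row 1. If
  \<open>j\<close> were one of them, the edge from \<open>c\<close> to \<open>j\<close> would close
  a cycle, contrary to \<sigma> being in \<open>good1\<close>. Hence only finitely many lists can
  occur as paths.\<close>

lemma chain_distinct:
  assumes "\<sigma> \<in> good1" "set xs \<subseteq> C" "chain \<sigma> j xs"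
  shows "distinct (j # xs)"
  using assms(2,3)
proof (induction xs arbitrary: j)
  case (Cons c cs)
  have d: "distinct (c # cs)" using Cons.prems by (intro Cons.IH) auto
  have "acyclic (chain_edges j (c # cs))"
    using chain_edges_subset[OF d Cons.prems] assms(1) acyclic_subset by (auto simp: good1_def)
  then have "(j, c) \<notin> (chain_edges c cs)\<^sup>*"
    using d by (simp add: chain_edges_Cons acyclic_insert)
  moreover have "(a, c) \<in> (chain_edges c cs)\<^sup>*" if "a \<in> set (c # cs)" for a
    using that d chain_edges_reach[of cs a c] by auto
  ultimately show ?case using d by auto
qed simp

text \<open>Injectivity of \<sigma> leaves one possible next column, and membership in
  \<open>U\<close> decides whether the path stops.\<close>

lemma path_unique: "path U \<sigma> j xs \<Longrightarrow> path U \<sigma> j ys \<Longrightarrow> \<sigma> permutes V \<Longrightarrow> xs = ys"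
proof (induction xs arbitrary: j ys)
  case Nil
  then show ?case by (cases ys) auto
next
  case (Cons c cs)
  then obtain d ds where ys: "ys = d # ds" by (cases ys) auto
  with Cons.prems have "\<sigma> (lst c) = \<sigma> (lst d)" by simp
  then have "c = d" using permutes_inj[OF Cons.prems(3)] by (metis fst_lst injD)
  with Cons ys show ?case by auto
qed

lemma escaping_iff_path:
  assumes "\<sigma> permutes V" "U \<subseteq> {1..K}" "j \<in> {1..K}"
  shows "(\<exists>z\<in>{1..K} - U. (j, z) \<in> (edges2 U (inv \<sigma>) (\<sigma> ` lst ` C))\<^sup>*) \<longleftrightarrow> (\<exists>xs. path U \<sigma> j xs)"
proof
  assume "\<exists>z\<in>{1..K} - U. (j, z) \<in> (edges2 U (inv \<sigma>) (\<sigma> ` lst ` C))\<^sup>*"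
  then obtain z where z: "z \<notin> U" "(j, z) \<in> (edges2 U (inv \<sigma>) (\<sigma> ` lst ` C))\<^sup>*" by auto
  from z(2) show "\<exists>xs. path U \<sigma> j xs"
  proof (induction rule: converse_rtrancl_induct)
    case base
    then show ?case using z(1) by (intro exI[of _ "[]"]) simp
  next
    case (step y c)
    then obtain xs where "path U \<sigma> c xs" by auto
    with step(1) have "path U \<sigma> y (c # xs)" by (simp add: edges2_iff[OF assms(1,2)])
    then show ?case by blast
  qed
next
  assume "\<exists>xs. path U \<sigma> j xs"
  then obtain xs where "path U \<sigma> j xs" by auto
  then show "\<exists>z\<in>{1..K} - U. (j, z) \<in> (edges2 U (inv \<sigma>) (\<sigma> ` lst ` C))\<^sup>*"
    using assms(3)
  proof (induction xs arbitrary: j)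
    case Nil
    then show ?case by auto
  next
    case (Cons c cs)
    then have "c \<in> {1..K}" using C_subset by auto
    moreover have "path U \<sigma> c cs" using Cons.prems by simp
    ultimately obtain z where "z \<in> {1..K} - U" "(c, z) \<in> (edges2 U (inv \<sigma>) (\<sigma> ` lst ` C))\<^sup>*"
      using Cons.IH by blast
    moreover have "(j, c) \<in> edges2 U (inv \<sigma>) (\<sigma> ` lst ` C)"
      using Cons.prems by (simp add: edges2_iff[OF assms(1,2)])
    ultimately show ?case by (meson converse_rtrancl_into_rtrancl)
  qed
qed

definition critical_lists :: "nat list set" where "critical_lists = {xs. set xs \<subseteq> C \<and> distinct xs}"

lemma finite_critical_lists: "finite critical_lists"
  unfolding critical_lists_def using finite_C by (rule finite_subset_distinct)

lemma card_escaping: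
  assumes "\<sigma> \<in> good1" "U \<subseteq> {1..K}"
  shows "card (escaping U \<sigma>) = (\<Sum>xs\<in>critical_lists. card {y \<in> V - lst ` C. path U \<sigma> (fst y) xs})"
proof -
  have perm: "\<sigma> permutes V" using assms by (simp add: good1_def)
  have "xs \<in> critical_lists" if "path U \<sigma> j xs" for j xs
    using that chain_distinct[OF assms(1)] by (auto simp: path_iff critical_lists_def)
  moreover have "escaping U \<sigma> = {y \<in> V - lst ` C. \<exists>xs. path U \<sigma> (fst y) xs}"
    unfolding escaping_def using escaping_iff_path[OF perm assms(2) fst_in_columns] by blast
  ultimately have "escaping U \<sigma> = (\<Union>xs\<in>critical_lists. {y \<in> V - lst ` C. path U \<sigma> (fst y) xs})" by auto
  then show ?thesis
    using finite_critical_lists finite_V path_unique[OF _ _ perm]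
    by (subst card_UN_disjoint[symmetric]) auto
qed

text \<open>
  In the proof, \<open>X\<close> is the set of vertices whose column leads to the head \<open>c\<close> of the chain, and \<open>Y\<close> the
  set of those in a root column.  Starting in \<open>X\<close> closes a cycle, and starting in \<open>Y\<close> connects \<open>X\<close> to
  a root; the sum over the starting vertex no longer involves the size of \<open>X\<close>.
\<close>

lemma sum_card_chain:
  assumes "xs \<in> critical_lists"
  shows "(\<Sum>y\<in>V - lst ` C. card {\<sigma> \<in> good1. chain \<sigma> (fst y) xs}) =
    card {b \<in> V. fst b \<in> \<R>} * (card V - card C) * fact (card V - length xs - 1)"
proof (cases xs)
  case Nil
  \<comment> \<open>No arrow ends in a marked column, so with nothing prescribed only the vertices
    lying in marked columns are connected to a root.\<close>
  have "(fst b, z) \<in> (Map.graph \<phi>)\<^sup>* \<longleftrightarrow> fst b = z" if "z \<in> \<R>" for b :: vertex and z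
    using that Range_graph_phi by (intro Not_Range_rtrancl) (auto simp: C_def)
  then have "{b \<in> V. \<exists>z\<in>\<R>. (fst b, z) \<in> (Map.graph \<phi>)\<^sup>*} = {b \<in> V. fst b \<in> \<R>}" by auto
  moreover have "row1.edges id {} = Map.graph \<phi>" by (simp add: row1.edges_def)
  ultimately have "card good1 = card {b \<in> V. fst b \<in> \<R>} * fact (card V - 1)"
    using row1.card_forests[of "{}" id] card_C_less acyclic_graph_phi by (simp add: good1_def)
  moreover have "card (V - lst ` C) = card V - card C"
    using row1.L_subset finite_C by (simp add: card_Diff_subset card_lst)
  ultimately show ?thesis by (simp add: Nil)
next
  case (Cons c cs)
  define E where "E = chain_edges c cs"
  have xs: "distinct xs" "set xs \<subseteq> C" using assms by (auto simp: critical_lists_def)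
  then have d: "distinct (c # cs)" "set (c # cs) \<subseteq> C" by (auto simp: Cons)
  define p where "p = length xs"
  define X where "X = {b \<in> V. (fst b, c) \<in> E\<^sup>*}"
  define Y where "Y = {b \<in> V. fst b \<in> \<R>}"
  have fin: "finite X" "finite Y" using finite_V by (auto simp: X_def Y_def)
  have E: "chain_edges j xs = insert (c, j) E" for j
    using d by (simp add: Cons E_def chain_edges_Cons)
  have acycE: "acyclic E" unfolding E_def using d by (rule acyclic_chain_edges)
  have Domain_E: "Domain E = dom \<phi> \<union> set cs" by (simp add: E_def Domain_chain_edges)
  have Range_E: "Range E \<subseteq> C" using Range_chain_edges[of cs c] d by (auto simp: E_def)
  have R_E: "(a, z) \<in> E\<^sup>* \<longleftrightarrow> a = z" if "z \<in> \<R>" for a z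
    using that Range_E by (intro Not_Range_rtrancl) (auto simp: C_def)
  have reach: "(a, c) \<in> E\<^sup>*" if "a \<in> set xs" for a
    using that d chain_edges_reach[of cs a c] by (auto simp: Cons E_def)
  have reach_C: "a \<in> set xs" if "(a, c) \<in> E\<^sup>*" "a \<in> C" for a
    using that(1)
  proof (cases rule: converse_rtranclE)
    case (step y)
    then have "a \<in> dom \<phi> \<union> set cs" using Domain_E by auto
    with that show ?thesis by (auto simp: Cons C_def)
  qed (simp add: Cons)
  have XY: "X \<inter> Y = {}"
  proof -
    have "a \<notin> \<R>" if "(a, c) \<in> E\<^sup>*" for a
      using that
    proof (cases rule: converse_rtranclE)
      case base
      then show ?thesis using d by (auto simp: C_def)
    next
      case (step y)
      then have "a \<in> dom \<phi> \<union> set cs" using Domain_E by auto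
      then show ?thesis using d dom_phi by (auto simp: C_def)
    qed
    then show ?thesis by (auto simp: X_def Y_def)
  qed
  \<comment> \<open>A critical column outside the list has no outgoing edge in \<open>E\<close> and
    differs from \<open>c\<close>, so it does not lead to \<open>c\<close>. Thus \<open>X\<close>
    contains exactly p critical vertices, whatever its size.\<close>
  have XC: "lst ` C \<inter> X = lst ` set xs"
    using reach reach_C xs C_subset by (auto simp: X_def)
  have YC: "lst ` C \<inter> Y = {}" by (auto simp: Y_def C_def)
  have p: "card (lst ` set xs) = p" using xs by (simp add: card_lst p_def distinct_card)
  have pX: "p \<le> card X" using p XC fin card_mono by (metis Int_lower2)
  have pV: "p < card V"
    using card_mono[OF finite_C xs(2)] card_C_less xs by (simp add: p_def distinct_card)
  have count: "card {\<sigma> \<in> good1. chain \<sigma> (fst y) xs} =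
    (if y \<in> X then 0 else if y \<in> Y then card X + card Y - p else card Y) * fact (card V - p - 1)"
    if y: "y \<in> V" for y
  proof (cases "y \<in> X")
    case True
    have "\<not> (\<sigma> \<in> good1 \<and> chain \<sigma> (fst y) xs)" for \<sigma>
    proof
      assume \<sigma>: "\<sigma> \<in> good1 \<and> chain \<sigma> (fst y) xs"
      then have "acyclic (row1.edges \<sigma> V)" "chain_edges (fst y) xs \<subseteq> row1.edges \<sigma> V"
        using chain_edges_subset[OF xs] by (auto simp: good1_def)
      then have "acyclic (chain_edges (fst y) xs)" by (rule acyclic_subset)
      with True show False by (simp add: E acyclic_insert X_def)
    qed
    then have "{\<sigma> \<in> good1. chain \<sigma> (fst y) xs} = {}" by blast
    with True show ?thesis by (simp only: card.empty) simp
  next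
    case False
    let ?j = "fst y"
    let ?P = "lst ` set xs"
    \<comment> \<open>The chain as a prescription on the last vertices of the listed columns. Its
      values, no longer available as images, are the last vertices of \<open>?j\<close> and of all
      listed columns but the final one.\<close>
    define g where "g v = lst (pred_in ?j xs (fst v))" for v :: vertex
    have j: "?j \<in> {1..K}" using y by (rule fst_in_columns)
    have notin: "?j \<notin> set xs" using False y reach by (auto simp: X_def)
    have gP: "g ` ?P = lst ` set (butlast (?j # xs))"
    proof -
      have "pred_in i xs ` set xs = set (butlast (i # xs))" if "distinct xs" for i and xs :: "nat list"
        using that
      proof (induction xs arbitrary: i)
        case (Cons a as)
        have "pred_in i (a # as) ` set as = pred_in a as ` set as"
          using Cons.prems by (intro image_cong) auto
        with Cons show ?case by simp
      qed simp
      from this[OF xs(1), of ?j] show ?thesis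
        by (metis (no_types, lifting) fst_lst g_def image_cong image_image)
    qed
    have "set (butlast (?j # xs)) \<subseteq> insert ?j (set xs)" by (auto dest: in_set_butlastD)
    then have gPV: "g ` ?P \<subseteq> V" using j xs C_subset unfolding gP by force
    have card_gP: "card (g ` ?P) = p"
      unfolding gP card_lst using xs notin
      by (subst distinct_card) (auto simp: distinct_butlast p_def simp del: butlast.simps)
    have inj_g: "inj_on g ?P" using card_gP p by (intro eq_card_imp_inj_on) auto
    have edges_g: "row1.edges g ?P = insert (c, ?j) E"
    proof -
      have "lst ` C \<inter> ?P = ?P" using xs by auto
      then have "row1.edges g ?P = chain_edges ?j xs"
        by (auto simp: row1.edges_def chain_edges_def g_def image_image)
      then show ?thesis by (simp only: E)
    qed
    have acyc: "acyclic (row1.edges g ?P)"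
      using acycE False y by (simp add: edges_g acyclic_insert X_def)
    have eq: "{\<sigma> \<in> good1. chain \<sigma> ?j xs} =
      {\<sigma>. \<sigma> permutes V \<and> (\<forall>a\<in>?P. \<sigma> a = g a) \<and> acyclic (row1.edges \<sigma> V)}"
      using xs by (auto simp: good1_def chain_iff_pred_in g_def)
    have forests: "card {\<sigma> \<in> good1. chain \<sigma> ?j xs} = card {b \<in> V - g ` ?P. \<exists>z\<in>\<R>. (fst b, z) \<in> (row1.edges g ?P)\<^sup>*} *
       fact (card V - card ?P - 1)"
      unfolding eq using xs C_subset pV p by (intro row1.card_forests inj_g gPV acyc) auto
    have "card {b \<in> V - g ` ?P. \<exists>z\<in>\<R>. (fst b, z) \<in> (row1.edges g ?P)\<^sup>*} =
      (if y \<in> Y then card X + card Y - p else card Y)"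
    proof -
      have "(a, z) \<in> (row1.edges g ?P)\<^sup>* \<longleftrightarrow> a = z \<or> (a, c) \<in> E\<^sup>* \<and> ?j = z" if "z \<in> \<R>" for a z
        by (simp add: edges_g rtrancl_insert R_E[OF that])
      then have "(\<exists>z\<in>\<R>. (a, z) \<in> (row1.edges g ?P)\<^sup>*) \<longleftrightarrow> (\<exists>z\<in>\<R>. a = z \<or> (a, c) \<in> E\<^sup>* \<and> ?j = z)" for a
        by (intro bex_cong refl) simp
      then have *: "(\<exists>z\<in>\<R>. (a, z) \<in> (row1.edges g ?P)\<^sup>*) \<longleftrightarrow> a \<in> \<R> \<or> (a, c) \<in> E\<^sup>* \<and> ?j \<in> \<R>" for a
        by blast
      have set_eq: "{b \<in> V - g ` ?P. \<exists>z\<in>\<R>. (fst b, z) \<in> (row1.edges g ?P)\<^sup>*} =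
        (if y \<in> Y then X \<union> Y else Y) - g ` ?P"
        unfolding * using y by (auto simp: X_def Y_def)
      \<comment> \<open>Of the p used vertices, those in listed columns lie in \<open>X\<close>, and
        the last vertex of \<open>?j\<close> lies in \<open>Y\<close> exactly when y does. Hence
        they all belong to the union of \<open>X\<close> and \<open>Y\<close> if y is in
        \<open>Y\<close>, and none of them is in \<open>Y\<close> otherwise.\<close>
      have butl: "set (butlast (?j # xs)) = insert ?j (set (butlast xs))"
        by (simp add: Cons)
      have bX: "lst ` set (butlast xs) \<subseteq> X"
        using reach xs C_subset by (auto simp: X_def dest!: in_set_butlastD)
      show ?thesis
      proof (cases "y \<in> Y")
        case True
        then have "g ` ?P \<subseteq> X \<union> Y"
          using bX j unfolding gP butl by (auto simp: Y_def)
        then have "card ((X \<union> Y) - g ` ?P) = card X + card Y - p"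
          using fin XY card_gP by (simp add: card_Diff_subset card_Un_disjoint finite_subset)
        with True set_eq show ?thesis by simp
      next
        case False
        then have "Y - g ` ?P = Y"
          using bX XY y unfolding gP butl by (auto simp: Y_def)
        with False set_eq show ?thesis by simp
      qed
    qed
    with forests show ?thesis using False p by (simp only: if_False)
  qed
  let ?B = "V - lst ` C"
  have finB: "finite ?B" using finite_V by simp
  have CV: "lst ` C \<subseteq> V" by (rule row1.L_subset)
  have YB: "Y \<subseteq> ?B" using YC by (auto simp: Y_def)
  have "(\<Sum>y\<in>?B. card {\<sigma> \<in> good1. chain \<sigma> (fst y) xs}) =
    (\<Sum>y\<in>?B. (if y \<in> X then 0 else if y \<in> Y then card X + card Y - p else card Y)) * fact (card V - p - 1)"
    unfolding sum_distrib_right by (intro sum.cong) (auto simp: count)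
  also have "(\<Sum>y\<in>?B. (if y \<in> X then 0 else if y \<in> Y then card X + card Y - p else card Y)) =
     card Y * (card X + card Y - p) + card (?B - X - Y) * card Y"
  proof -
    let ?f = "\<lambda>y. if y \<in> X then 0 else if y \<in> Y then card X + card Y - p else card Y"
    have "sum ?f ?B = sum ?f (?B - X)"
      using finB by (intro sum.mono_neutral_right) auto
    also have "\<dots> = sum ?f (?B - X - Y) + sum ?f Y"
      using finB YB XY by (intro sum.subset_diff) auto
    also have "sum ?f Y = (\<Sum>y\<in>Y. card X + card Y - p)"
      using XY by (intro sum.cong) auto
    finally show ?thesis by simp
  qed
  also have "card (?B - X - Y) = card V - card C - (card X - p) - card Y"
  proof -
    have "?B - X - Y = V - (lst ` C \<union> X \<union> Y)" by auto
    also have "card \<dots> = card V - card (lst ` C \<union> X \<union> Y)"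
      using fin finite_C CV by (intro card_Diff_subset) (auto simp: X_def Y_def)
    also have "card (lst ` C \<union> X \<union> Y) = card (lst ` C \<union> X) + card Y"
      using fin finite_C XY YC by (intro card_Un_disjoint) auto
    also have "card (lst ` C \<union> X) = card C + card X - p"
      using card_Un_Int[of "lst ` C" X] fin finite_C XC p by (simp add: card_lst)
    finally show ?thesis using pX by simp
  qed
  also have "card Y * (card X + card Y - p) + (card V - card C - (card X - p) - card Y) * card Y =
    card Y * (card V - card C)"
  proof -
    have "lst ` C \<union> X \<union> Y \<subseteq> V" using CV by (auto simp: X_def Y_def)
    then have "card (lst ` C \<union> X \<union> Y) \<le> card V" using finite_V card_mono by blast
    moreover have "card (lst ` C \<union> X \<union> Y) = card (lst ` C \<union> X) + card Y"
      using fin finite_C XY YC by (intro card_Un_disjoint) auto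
    moreover have "card (lst ` C \<union> X) = card C + card X - p"
      using card_Un_Int[of "lst ` C" X] fin finite_C XC p by (simp add: card_lst)
    ultimately have "(card X + card Y - p) + (card V - card C - (card X - p) - card Y) = card V - card C"
      using pX by linarith
    moreover have "k * a + b * k = k * c" if "a + b = c" for a b c k :: nat
      using that by (auto simp: algebra_simps)
    ultimately show ?thesis by blast
  qed
  finally show ?thesis by (simp add: Y_def p_def)
qed

section \<open>Summation over the unmarked sets and the paths\<close>

definition num_unmarked :: "nat \<Rightarrow> nat \<Rightarrow> nat" where
  "num_unmarked u p = (if p \<le> u then (K - 1 - p) choose (u - p) else 0)"

text \<open>By distinctness the path forces exactly p = \<open>length xs\<close> columns into
  \<open>U\<close>, namely all but its last one, and that last one out of \<open>U\<close>. Only the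
  length matters.\<close>

lemma card_unmarked_path:
  assumes "\<sigma> \<in> good1" "xs \<in> critical_lists" "j \<in> {1..K}"
  shows "card {U. U \<subseteq> {1..K} \<and> card U = u \<and> path U \<sigma> j xs} =
    (if chain \<sigma> j xs then num_unmarked u (length xs) else 0)"
proof (cases "chain \<sigma> j xs")
  case True
  have xs: "set xs \<subseteq> C" using assms by (simp add: critical_lists_def)
  have d: "distinct (j # xs)" using chain_distinct[OF assms(1) xs True] .
  let ?B = "set (butlast (j # xs))"
  have sub: "set (j # xs) \<subseteq> {1..K}" using assms(3) xs C_subset by auto
  then have B: "?B \<subseteq> {1..K}" by (blast dest: in_set_butlastD)
  have "distinct (butlast (j # xs) @ [last (j # xs)])"
    using d by (simp only: append_butlast_last_id list.distinct not_False_eq_True)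
  then have notin: "last (j # xs) \<notin> ?B" by (simp only: distinct_append) auto
  have "last (j # xs) \<in> set (j # xs)" by (rule last_in_set) simp
  with sub have z: "last (j # xs) \<in> {1..K}" by blast
  have "card ?B = length xs"
    using d by (metis diff_Suc_1 distinct_butlast distinct_card length_Cons length_butlast)
  moreover have "{U. U \<subseteq> {1..K} \<and> card U = u \<and> path U \<sigma> j xs} =
    {U. U \<subseteq> {1..K} \<and> card U = u \<and> ?B \<subseteq> U \<and> last (j # xs) \<notin> U}"
    using True xs by (simp only: path_iff simp_thms)
  moreover have "last (j # xs) \<in> {1..K} - ?B" using z notin by blast
  ultimately show ?thesis
    using True card_subsets_between[OF _ B] by (simp only: num_unmarked_def) simp
next
  case False
  then have "{U. U \<subseteq> {1..K} \<and> card U = u \<and> path U \<sigma> j xs} = {}" by (auto simp: path_iff)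
  with False show ?thesis by (simp only: card.empty if_False)
qed

text \<open>The identity is proved after multiplication by the positive number |V| - |C|. On the
  left this factor turns pairs into escaping vertices, by \<open>good_pairs_count\<close>; on the
  right it is supplied by \<open>sum_card_chain\<close>.\<close>

theorem good_pairs_total:
  "(\<Sum>U | U \<subseteq> {1..K} \<and> card U = u. card (good1 \<inter> good2 U)) =
    card {b \<in> V. fst b \<in> \<R>} *
      (\<Sum>p\<le>card C. \<Prod>{card C - p + 1..card C} * fact (card V - p - 1) * num_unmarked u p)"
proof -
  let ?UU = "{U. U \<subseteq> {1..K} \<and> card U = u}"
  let ?B = "V - lst ` C"
  let ?r = "card {b \<in> V. fst b \<in> \<R>}"
  let ?m = "card V - card C"
  let ?h = "\<lambda>p. fact (card V - p - 1) * num_unmarked u p"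
  have finU: "finite ?UU" by (rule finite_subset[of _ "Pow {1..K}"]) auto
  have finB: "finite ?B" using finite_V by simp
  have "(\<Sum>U\<in>?UU. card (good1 \<inter> good2 U)) * ?m =
    (\<Sum>U\<in>?UU. \<Sum>\<sigma>\<in>good1. \<Sum>xs\<in>critical_lists. card {y \<in> ?B. path U \<sigma> (fst y) xs})"
    unfolding sum_distrib_right
    by (intro sum.cong refl) (simp add: good_pairs_count card_escaping cong: sum.cong)
  \<comment> \<open>The sum over \<open>U\<close> becomes innermost because, for a fixed chain, it
    depends only on the length of the list; the sum over \<sigma> then involves chains
    alone.\<close>
  also have "\<dots> = (\<Sum>xs\<in>critical_lists. \<Sum>\<sigma>\<in>good1. \<Sum>U\<in>?UU. card {y \<in> ?B. path U \<sigma> (fst y) xs})"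
    by (subst sum.swap, subst (2) sum.swap, subst sum.swap) (rule refl)
  also have "\<dots> = (\<Sum>xs\<in>critical_lists. \<Sum>\<sigma>\<in>good1. \<Sum>y\<in>?B. if chain \<sigma> (fst y) xs then num_unmarked u (length xs) else 0)"
  proof (intro sum.cong refl sum_multicount_gen finU finB ballI)
    fix xs \<sigma> y assume "xs \<in> critical_lists" "\<sigma> \<in> good1" "y \<in> ?B"
    then show "card {U \<in> ?UU. path U \<sigma> (fst y) xs} = (if chain \<sigma> (fst y) xs then num_unmarked u (length xs) else 0)"
      using card_unmarked_path[of \<sigma> xs "fst y" u] fst_in_columns[of y] by (simp add: conj_assoc)
  qed
  also have "\<dots> = (\<Sum>xs\<in>critical_lists. (\<Sum>y\<in>?B. card {\<sigma> \<in> good1. chain \<sigma> (fst y) xs}) * num_unmarked u (length xs))"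
    unfolding sum_distrib_right
    by (intro sum.cong refl, subst sum.swap)
      (intro sum.cong refl, simp add: sum.inter_filter[symmetric] finite_good1)
  also have "\<dots> = (\<Sum>xs\<in>critical_lists. ?r * ?m * ?h (length xs))"
    by (intro sum.cong refl) (simp add: sum_card_chain)
  also have "\<dots> = (\<Sum>p\<le>card C. \<Sum>xs | xs \<in> critical_lists \<and> length xs = p. ?r * ?m * ?h (length xs))"
  proof (rule sum.group[symmetric])
    show "length ` critical_lists \<subseteq> {..card C}"
      using finite_C by (auto simp: critical_lists_def) (metis card_mono distinct_card)
  qed (auto simp: finite_critical_lists)
  also have "\<dots> = (\<Sum>p\<le>card C. \<Prod>{card C - p + 1..card C} * (?r * ?m * ?h p))"
  proof (intro sum.cong refl)
    fix p assume "p \<in> {..card C}"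
    then have "card {xs. length xs = p \<and> distinct xs \<and> set xs \<subseteq> C} = \<Prod>{card C - p + 1..card C}"
      using finite_C by (intro card_lists_distinct_length_eq) auto
    moreover have "{xs \<in> critical_lists. length xs = p} = {xs. length xs = p \<and> distinct xs \<and> set xs \<subseteq> C}"
      by (auto simp: critical_lists_def)
    moreover have "(\<Sum>xs | xs \<in> critical_lists \<and> length xs = p. ?r * ?m * ?h (length xs)) =
      (\<Sum>xs | xs \<in> critical_lists \<and> length xs = p. ?r * ?m * ?h p)"
      by (intro sum.cong) auto
    ultimately show "(\<Sum>xs | xs \<in> critical_lists \<and> length xs = p. ?r * ?m * ?h (length xs)) =
      \<Prod>{card C - p + 1..card C} * (?r * ?m * ?h p)"
      by (simp only: sum_constant of_nat_id)
  qed
  also have "\<dots> = ?r * (\<Sum>p\<le>card C. \<Prod>{card C - p + 1..card C} * fact (card V - p - 1) * num_unmarked u p) * ?m"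
    by (simp add: sum_distrib_left sum_distrib_right mult_ac)
  finally show ?thesis using card_C_less by simp
qed

section \<open>Arrays as permutations\<close>

text \<open>\<open>w\<close> is arbitrary outside the grid, whereas cell sizes of arrays vanish
  there.\<close>

definition grid_size :: "nat \<Rightarrow> nat" where
  "grid_size j = (if j \<in> {1..K} then w j else 0)"

text \<open>The pairing is restricted to \<open>V\<close> because pairings are extensional, while a
  permutation is the identity outside \<open>V\<close>.\<close>

definition array_of :: "nat set \<Rightarrow> (vertex \<Rightarrow> vertex) \<Rightarrow> vertical_array" where
  "array_of U \<sigma> = \<lparr>size_of = (\<lambda>i. grid_size),
     marked = (\<lambda>i. case i of Row1 \<Rightarrow> \<R> | Row2 \<Rightarrow> {1..K} - U),
     pairing = restrict \<sigma> V\<rparr>"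

lemma array_of_sel [simp]:
  "size_of (array_of U \<sigma>) i = grid_size"
  "marked (array_of U \<sigma>) Row1 = \<R>"
  "marked (array_of U \<sigma>) Row2 = {1..K} - U"
  "pairing (array_of U \<sigma>) = restrict \<sigma> V"
  by (simp_all add: array_of_def)

lemma vertices_grid_size [simp]: "vertices K grid_size = V"
  by (auto simp: vertices_def grid_size_def)

lemma rightmost_grid_size: "j \<in> {1..K} \<Longrightarrow> rightmost grid_size j = lst j"
  by (simp add: rightmost_def grid_size_def)

lemma grid_size_pos: "j \<in> {1..K} \<Longrightarrow> grid_size j > 0"
  using w_pos by (simp add: grid_size_def)

lemma psi1_array_of:
  "psi1 K (array_of U \<sigma>) \<phi> j = (if j \<in> \<R> then None else if j \<in> dom \<phi> then \<phi> j
     else if j \<in> {1..K} then Some (fst (\<sigma> (lst j))) else None)"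
proof (cases "j \<in> {1..K}")
  case True
  then have "partner K (array_of U \<sigma>) Row1 (rightmost grid_size j) = \<sigma> (lst j)"
    by (simp add: partner_def rightmost_grid_size)
  with True grid_size_pos[OF True] show ?thesis
    by (simp only: psi1_def array_of_sel simp_thms if_True)
next
  case False
  then show ?thesis by (simp only: psi1_def array_of_sel simp_thms if_False)
qed

lemma psi2_array_of:
  assumes "\<sigma> permutes V" "U \<subseteq> {1..K}"
  shows "psi2 K (array_of U \<sigma>) j = (if j \<in> U then Some (fst (inv \<sigma> (lst j))) else None)"
proof (cases "j \<in> {1..K}")
  case True
  then have j: "lst j \<in> V" "w j > 0" using w_pos by auto
  have "inv_into V (restrict \<sigma> V) (lst j) = inv \<sigma> (lst j)"
  proof (rule inv_into_f_eq)
    show "inj_on (restrict \<sigma> V) V"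
      using permutes_inj_on[OF assms(1)] by (simp add: inj_on_def)
    show "inv \<sigma> (lst j) \<in> V"
      using j permutes_in_image[OF permutes_inv[OF assms(1)]] by simp
    then show "restrict \<sigma> V (inv \<sigma> (lst j)) = lst j"
      using permutes_inverses(1)[OF assms(1)] by simp
  qed
  then have "partner K (array_of U \<sigma>) Row2 (rightmost grid_size j) = inv \<sigma> (lst j)"
    using True by (simp add: partner_def rightmost_grid_size)
  with True grid_size_pos[OF True] show ?thesis
    by (simp add: psi2_def)
next
  case False
  with assms(2) have "j \<notin> U" by blast
  with False show ?thesis by (simp only: psi2_def simp_thms if_False if_cancel)
qed

text \<open>Since no cell is empty, both partial maps are defined on all unmarked columns of their
  row and stay inside the grid. Every place where an orbit can stop is therefore marked, and
  \<open>leads_to_iff_acyclic\<close> applies to each row.\<close>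

lemma forest_condition_array_of:
  assumes \<sigma>: "\<sigma> permutes V" and U: "U \<subseteq> {1..K}"
  shows "forest_condition K (array_of U \<sigma>) \<phi> \<longleftrightarrow> \<sigma> \<in> good1 \<inter> good2 U"
proof -
  let ?\<psi>1 = "psi1 K (array_of U \<sigma>) \<phi>" and ?\<psi>2 = "psi2 K (array_of U \<sigma>)"
  have col: "fst (\<sigma> (lst j)) \<in> {1..K}" "fst (inv \<sigma> (lst j)) \<in> {1..K}" if "j \<in> {1..K}" for j
    using that fst_in_columns permutes_in_image[OF \<sigma>] permutes_in_image[OF permutes_inv[OF \<sigma>]]
    by (metis lst_in_V)+
  have dom1: "dom ?\<psi>1 = {1..K} - \<R>"
    using dom_phi by (auto simp: dom_def psi1_array_of split: if_splits)
  have ran1: "ran ?\<psi>1 \<subseteq> {1..K}"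
  proof
    fix k assume "k \<in> ran ?\<psi>1"
    then obtain j where "?\<psi>1 j = Some k" by (auto simp: ran_def)
    then have "\<phi> j = Some k \<or> j \<in> {1..K} \<and> k = fst (\<sigma> (lst j))"
      unfolding psi1_array_of by (auto split: if_splits)
    then show "k \<in> {1..K}" using col(1) ran_phi ranI[of \<phi> j k] by blast
  qed
  have g1: "Map.graph ?\<psi>1 = row1.edges \<sigma> V"
  proof (rule set_eqI, clarify)
    fix j k
    show "(j, k) \<in> Map.graph ?\<psi>1 \<longleftrightarrow> (j, k) \<in> row1.edges \<sigma> V"
      unfolding edges1_iff using dom_phi
      by (auto simp: Map.graph_def psi1_array_of C_def)
  qed
  have "leads_to ?\<psi>1 \<R> \<longleftrightarrow> acyclic (Map.graph ?\<psi>1)"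
    using dom1 ran1 R_subset by (intro leads_to_iff_acyclic) auto
  then have 1: "leads_to ?\<psi>1 \<R> \<longleftrightarrow> \<sigma> \<in> good1"
    using \<sigma> by (simp add: g1 good1_def)
  have dom2: "dom ?\<psi>2 = U"
    by (auto simp: dom_def psi2_array_of[OF \<sigma> U])
  have ran2: "ran ?\<psi>2 \<subseteq> {1..K}"
  proof
    fix k assume "k \<in> ran ?\<psi>2"
    then obtain j where "?\<psi>2 j = Some k" by (auto simp: ran_def)
    then have "j \<in> U \<and> k = fst (inv \<sigma> (lst j))"
      unfolding psi2_array_of[OF \<sigma> U] by (auto split: if_splits)
    then show "k \<in> {1..K}" using col(2) U by blast
  qed
  have "lst ` U \<inter> V = lst ` U" using U by auto
  then have "edges2 U (inv \<sigma>) V = (\<lambda>j. (j, fst (inv \<sigma> (lst j)))) ` U"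
    by (simp add: forest_count.edges_def[OF row2[OF U]] image_image)
  also have "\<dots> = Map.graph ?\<psi>2"
    by (auto simp: Map.graph_def psi2_array_of[OF \<sigma> U] split: if_splits)
  finally have g2: "Map.graph ?\<psi>2 = edges2 U (inv \<sigma>) V" ..
  have "leads_to ?\<psi>2 ({1..K} - U) \<longleftrightarrow> acyclic (Map.graph ?\<psi>2)"
    using dom2 ran2 U finite_subset[OF U] by (intro leads_to_iff_acyclic) auto
  then have 2: "leads_to ?\<psi>2 ({1..K} - U) \<longleftrightarrow> \<sigma> \<in> good2 U"
    using \<sigma> by (simp add: g2 good2_def)
  show ?thesis using 1 2 by (simp add: forest_condition_def)
qed

theorem card_substructure:
  assumes s: "(\<Sum>j\<in>{1..K}. w j) = s" and R1: "card \<R> = R1" and R2: "R2 \<le> K"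
  shows "card (substructure K R1 R2 s w \<R> \<phi>) =
    (\<Sum>U | U \<subseteq> {1..K} \<and> card U = K - R2. card (good1 \<inter> good2 U))"
proof -
  let ?UU = "{U. U \<subseteq> {1..K} \<and> card U = K - R2}"
  have finU: "finite ?UU" by (rule finite_subset[of _ "Pow {1..K}"]) auto
  have arrow: "is_arrow_map K \<R> \<phi>"
    using dom_phi ran_phi by (auto simp: is_arrow_map_def)
  have vert: "is_vertical_array K R1 R2 s (array_of U \<sigma>)"
    if "\<sigma> permutes V" "U \<subseteq> {1..K}" "card U = K - R2" for U \<sigma>
  proof -
    have "(\<Sum>j\<in>{1..K}. grid_size j) = s" using s by (simp add: grid_size_def)
    moreover have "grid_size j = 0" if "j \<notin> {1..K}" for j using that by (simp only: grid_size_def if_False)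
    moreover have "marked (array_of U \<sigma>) i \<subseteq> {1..K}" for i
      using R_subset by (cases i) auto
    moreover have "card ({1..K} - U) = R2"
      using that R2 by (simp add: card_Diff_subset finite_subset)
    moreover have "bij_betw (restrict \<sigma> V) V V"
      using permutes_imp_bij[OF that(1)] by (simp add: bij_betw_restrict_eq)
    ultimately show ?thesis
      unfolding is_vertical_array_def array_of_sel vertices_grid_size using R1 by auto
  qed
  have "bij_betw (\<lambda>(U, \<sigma>). (array_of U \<sigma>, \<phi>)) (SIGMA U:?UU. good1 \<inter> good2 U)
    (substructure K R1 R2 s w \<R> \<phi>)"
  proof (rule bij_betwI')
    fix x y assume "x \<in> (SIGMA U:?UU. good1 \<inter> good2 U)" "y \<in> (SIGMA U:?UU. good1 \<inter> good2 U)"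
    then obtain U \<sigma> U' \<sigma>' where xy: "x = (U, \<sigma>)" "y = (U', \<sigma>')" "U \<subseteq> {1..K}" "U' \<subseteq> {1..K}"
      "\<sigma> permutes V" "\<sigma>' permutes V" by (auto simp: good1_def)
    have "U = U' \<and> \<sigma> = \<sigma>'" if "array_of U \<sigma> = array_of U' \<sigma>'"
    proof
      have "{1..K} - U = {1..K} - U'" "restrict \<sigma> V = restrict \<sigma>' V"
        using that array_of_sel by metis+
      then show "U = U'" using xy by blast
      show "\<sigma> = \<sigma>'"
      proof
        fix v show "\<sigma> v = \<sigma>' v"
          using fun_cong[OF \<open>restrict \<sigma> V = restrict \<sigma>' V\<close>, of v] xy(5,6)
          by (cases "v \<in> V") (auto simp: permutes_not_in)
      qed
    qed
    then show "((\<lambda>(U, \<sigma>). (array_of U \<sigma>, \<phi>)) x = (\<lambda>(U, \<sigma>). (array_of U \<sigma>, \<phi>)) y) = (x = y)"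
      by (auto simp: xy)
  next
    fix x assume "x \<in> (SIGMA U:?UU. good1 \<inter> good2 U)"
    then obtain U \<sigma> where x: "x = (U, \<sigma>)" "U \<subseteq> {1..K}" "card U = K - R2"
      "\<sigma> \<in> good1 \<inter> good2 U" "\<sigma> permutes V" by (auto simp: good1_def)
    then show "(\<lambda>(U, \<sigma>). (array_of U \<sigma>, \<phi>)) x \<in> substructure K R1 R2 s w \<R> \<phi>"
      using vert forest_condition_array_of arrow by (simp add: substructure_def AR_def grid_size_def)
  next
    fix y assume "y \<in> substructure K R1 R2 s w \<R> \<phi>"
    then obtain \<alpha> where y: "y = (\<alpha>, \<phi>)" and va: "is_vertical_array K R1 R2 s \<alpha>"
      and fc: "forest_condition K \<alpha> \<phi>" and m1: "marked \<alpha> Row1 = \<R>"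
      and sz: "\<forall>i. \<forall>j\<in>{1..K}. size_of \<alpha> i j = w j"
      by (auto simp: substructure_def AR_def)
    have "size_of \<alpha> i j = grid_size j" for i j
    proof (cases "j \<in> {1..K}")
      case True
      with sz show ?thesis by (simp only: grid_size_def if_True)
    next
      case False
      with va have "size_of \<alpha> i j = 0" unfolding is_vertical_array_def by blast
      with False show ?thesis by (simp only: grid_size_def if_False)
    qed
    then have sz': "size_of \<alpha> = (\<lambda>i. grid_size)" by (simp add: fun_eq_iff)
    define U where "U = {1..K} - marked \<alpha> Row2"
    \<comment> \<open>The identity replaces the undefined values of the pairing outside
      \<open>V\<close>, which makes \<sigma> a permutation.\<close>
    define \<sigma> where "\<sigma> v = (if v \<in> V then pairing \<alpha> v else v)" for v
    have m2: "marked \<alpha> Row2 = {1..K} - U"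
      using va by (auto simp: is_vertical_array_def U_def)
    have "marked \<alpha> Row2 \<subseteq> {1..K}" "card (marked \<alpha> Row2) = R2"
      using va by (auto simp: is_vertical_array_def)
    then have U: "U \<in> ?UU"
      by (auto simp: U_def card_Diff_subset finite_subset)
    have "bij_betw (pairing \<alpha>) V V" and ext: "pairing \<alpha> \<in> extensional V"
      using va by (auto simp: is_vertical_array_def sz')
    then have "bij_betw \<sigma> V V"
      by (subst bij_betw_cong[where g = "pairing \<alpha>"]) (auto simp: \<sigma>_def)
    then have \<sigma>: "\<sigma> permutes V"
      by (rule bij_imp_permutes) (simp add: \<sigma>_def)
    have "marked \<alpha> = (\<lambda>i. case i of Row1 \<Rightarrow> \<R> | Row2 \<Rightarrow> {1..K} - U)"
      using m1 m2 by (auto simp: fun_eq_iff split: row.split)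
    moreover have "pairing \<alpha> = restrict \<sigma> V"
      using ext by (auto simp: fun_eq_iff \<sigma>_def extensional_def)
    ultimately have \<alpha>: "\<alpha> = array_of U \<sigma>"
      using sz' by (intro vertical_array.equality) (simp_all add: array_of_def)
    then have "\<sigma> \<in> good1 \<inter> good2 U"
      using forest_condition_array_of[OF \<sigma>] U fc by simp
    then show "\<exists>x\<in>SIGMA U:?UU. good1 \<inter> good2 U. y = (\<lambda>(U, \<sigma>). (array_of U \<sigma>, \<phi>)) x"
      using U \<alpha> y by (intro bexI[of _ "(U, \<sigma>)"]) auto
  qed
  then have "card (substructure K R1 R2 s w \<R> \<phi>) = card (SIGMA U:?UU. good1 \<inter> good2 U)"
    by (rule bij_betw_same_card[symmetric])
  also have "\<dots> = (\<Sum>U\<in>?UU. card (good1 \<inter> good2 U))"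
    using finU finite_good1 by (intro card_SigmaI) auto
  finally show ?thesis .
qed

end

section \<open>The closed formula\<close>

theorem theorem4p2:
  fixes K s R1 R2 r M :: nat
    and w :: "nat \<Rightarrow> nat"
    and \<R>1 :: "nat set"
    and \<phi> :: "nat \<rightharpoonup> nat"
  assumes "K \<ge> 1"
    and "1 \<le> R1" "R1 \<le> K"
    and "1 \<le> R2" "R2 \<le> K"
    and "substructure_data K R1 s w \<R>1 \<phi>"
    and "irreducible_substructure \<R>1 \<phi>"
    and "\<forall>j\<in>{1..K}. w j > 0"
    and "r = (\<Sum>j\<in>\<R>1. w j)"
    and "M = card (critical_columns K w \<R>1 (dom \<phi>))"
  shows "real (card (substructure K R1 R2 s w \<R>1 \<phi>)) =
    fact s * (\<Sum>A<s. real r / (real s - real A)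
      * real (ibinom (int M) (int M - int A))
      * real (ibinom (int K - int M - 1) (int R2 - int M + int A - 1)))"
proof -
  have data: "(\<Sum>j\<in>{1..K}. w j) = s" "\<R>1 \<subseteq> {1..K}" "card \<R>1 = R1"
    "dom \<phi> \<subseteq> {1..K} - \<R>1" "ran \<phi> \<subseteq> {1..K}"
    using assms(6) by (auto simp: substructure_data_def is_arrow_map_def)
  interpret irreducible_grid K w \<R>1 \<phi>
  proof
    show "w j > 0" if "j \<in> {1..K}" for j using that assms(8) by blast
    show "\<R>1 \<noteq> {}" using data assms(2) by auto
    show "\<R>1 \<subseteq> {1..K}" "dom \<phi> \<subseteq> {1..K} - \<R>1" using data by auto
    show "ran \<phi> \<subseteq> {1..K} - \<R>1 - dom \<phi>"
    proof
      fix k assume k: "k \<in> ran \<phi>"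
      then obtain j where "\<phi> j = Some k" by (auto simp: ran_def)
      then have "k \<notin> \<R>1 \<union> dom \<phi>"
        using assms(7) by (force simp: irreducible_substructure_def)
      then show "k \<in> {1..K} - \<R>1 - dom \<phi>" using k data by auto
    qed
  qed
  have "critical_columns K w \<R>1 (dom \<phi>) = C"
  proof -
    have "critical K w \<R>1 (dom \<phi>) v \<longleftrightarrow> v \<in> lst ` C" for v
    proof
      assume v: "critical K w \<R>1 (dom \<phi>) v"
      then have "v = lst (fst v)" "fst v \<in> C"
        using fst_in_columns[of v] by (auto simp: critical_def C_def)
      then show "v \<in> lst ` C" by (rule image_eqI)
    next
      assume "v \<in> lst ` C"
      then obtain j where "v = lst j" "j \<in> C" by auto
      then show "critical K w \<R>1 (dom \<phi>) v"
        by (auto simp: critical_def C_def)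
    qed
    then show ?thesis by (auto simp: critical_columns_def)
  qed
  then have M: "card C = M" by (simp add: assms(10))
  have cardV: "card V = s"
    using data by (simp add: vertices_def)
  have cardR: "card {b \<in> V. fst b \<in> \<R>1} = r"
  proof -
    have "{b \<in> V. fst b \<in> \<R>1} = (SIGMA j:\<R>1. {1..w j})"
      using data by (auto simp: vertices_def)
    then show ?thesis using data assms(9) finite_subset[OF data(2)] by simp
  qed
  have Ms: "M < s" using card_C_less M cardV by simp
  have "C \<subset> {1..K}" using R_nonempty R_subset by (auto simp: C_def)
  then have MK: "M < K" using psubset_card_mono[of "{1..K}" C] M by simp
  define u where "u = K - R2"
  have "real (card (substructure K R1 R2 s w \<R>1 \<phi>)) =
    real r * (\<Sum>p\<le>M. fact M / fact (M - p) * fact (s - p - 1) *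
        real (if p \<le> u then (K - 1 - p) choose (u - p) else 0))"
  proof -
    have "real (card (substructure K R1 R2 s w \<R>1 \<phi>)) =
      real r * (\<Sum>p\<le>M. real (\<Prod>{M - p + 1..M}) * fact (s - p - 1) * real (num_unmarked u p))"
      using card_substructure[OF data(1,3) assms(5)] good_pairs_total[of u]
      by (simp add: M cardV cardR u_def del: of_nat_prod)
    also have "\<dots> = real r * (\<Sum>p\<le>M. fact M / fact (M - p) * fact (s - p - 1) * real (num_unmarked u p))"
      by (intro arg_cong2[where f = "(*)"] sum.cong refl) (subst real_prod_interval; simp)
    finally show ?thesis by (simp only: num_unmarked_def)
  qed
  also have "\<dots> = real r * (fact s * (\<Sum>A\<le>M. 1 / (real s - real A) * real (M choose A) *
        real (if A \<le> u then (K - M - 1) choose (u - A) else 0)))"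
    by (simp only: sum_falling_binomial[OF Ms MK])
  also have "\<dots> = fact s * (\<Sum>A\<le>M. real r / (real s - real A) * real (M choose A) *
        real (if A \<le> u then (K - M - 1) choose (u - A) else 0))"
    by (simp add: sum_distrib_left mult_ac)
  \<comment> \<open>For M < A < s the lower index M - A is negative and the term is 0; M < s keeps
    all remaining terms within the range.\<close>
  also have "(\<Sum>A\<le>M. real r / (real s - real A) * real (M choose A) *
        real (if A \<le> u then (K - M - 1) choose (u - A) else 0)) =
    (\<Sum>A<s. real r / (real s - real A)
      * real (ibinom (int M) (int M - int A))
      * real (ibinom (int K - int M - 1) (int R2 - int M + int A - 1)))"
  proof (rule sum.mono_neutral_cong_left)
    fix A assume "A \<in> {..M}"
    then have A: "A \<le> M" by simp
    have 1: "ibinom (int M) (int M - int A) = M choose A"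
      using A binomial_symmetric[OF A] by (simp add: ibinom_def nat_diff_distrib)
    \<comment> \<open>Binomial symmetry: with u = K - R2, the complement of u - A in K - M - 1 is R2
      - M + A - 1. This index exceeds K - M - 1 when A > u and is negative when u - A > K - M - 1,
      so the vanishing cases match.\<close>
    have 2: "ibinom (int K - int M - 1) (int R2 - int M + int A - 1) =
      (if A \<le> u then (K - M - 1) choose (u - A) else 0)"
    proof (cases "A \<le> u \<and> u - A \<le> K - M - 1")
      case True
      have "nat (int K - int M - 1) = K - M - 1" by simp
      moreover obtain d where d: "u = A + d" using True le_Suc_ex by blast
      define e where "e = K - M - 1 - d"
      have e: "K = M + 1 + d + e"
        using True MK d by (simp add: e_def)
      have "int R2 - int M + int A - 1 = int e"
        using d e assms(5) by (simp add: u_def)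
      moreover have "K - M - 1 - (u - A) = e" "int e \<le> int K - int M - 1"
        using d e by simp_all
      ultimately show ?thesis
        using True binomial_symmetric[of "u - A" "K - M - 1"] by (simp add: ibinom_def)
    next
      case False
      then have "int R2 - int M + int A - 1 < 0 \<or> int R2 - int M + int A - 1 > int K - int M - 1"
        using assms(5) MK by (auto simp: u_def)
      with False show ?thesis by (auto simp: ibinom_def binomial_eq_0)
    qed
    show "real r / (real s - real A) * real (M choose A) *
        real (if A \<le> u then (K - M - 1) choose (u - A) else 0) =
      real r / (real s - real A) * real (ibinom (int M) (int M - int A))
      * real (ibinom (int K - int M - 1) (int R2 - int M + int A - 1))"
      unfolding 1 2 ..
  qed (use Ms in \<open>auto simp: ibinom_def\<close>)
  finally show ?thesis .
qed

end
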